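(* For each $n\in\mathbb{N}$ let $\vec{k}^*=\vec k^*(n)=(k_i^* )_{i=1}^n\in\mathbb{N}_0^n$ be a graphical degree sequence (i.e., the degree sequence of at least one simple undirected graph on $n$ nodes), and consider the microcanonical and canonical ensembles $P_{\mathrm{mic}},P_{\mathrm{can}}$ on the set $\mathcal{G}_n$ of all simple undirected graphs with $n$ nodes, with constraint $\vec{C}^*=\vec{k}^*$ on the degree sequence $\vec{C}(\mathbf{G})=\vec{k}(\mathbf{G})=(k_i(\mathbf{G}))_{i=1}^n$. Suppose that $$\max_{1\le i\le n}k_i^*=o(\sqrt{n}),\qquad n\to\infty,$$ and that there exists a probability distribution $f$ on $\mathbb{N}_0$ such that the empirical degree distributions $f_n=n^{-1}\sum_{i=1}^n\delta_{k_i^*}$ satisfy $$\lim_{n\to\infty}\|f_n-f\|_{\ell^1(g)}=0.$$ Then the limiting specific relative entropy $s_\infty=\lim_{n\to\infty}n^{-1}S_n(P_{\mathrm{mic}}\mid P_{\mathrm{can}})$ equals $$s_\infty=\|f\|_{\ell^1(g)}>0.$$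
   Context: $\mathbb{N}=\{1,2,\ldots\}$, $\mathbb{N}_0=\mathbb{N}\cup\{0\}$; $\delta_k$ is the point measure at $k$. A graph $\mathbf{G}$ on $n$ nodes has adjacency entries $g_{i,j}(\mathbf{G})\in\{0,1\}$, equal to $1$ iff there is a link between nodes $i$ and $j$; the degree of node $i$ is $k_i(\mathbf{G})=\sum_{j\ne i}g_{i,j}(\mathbf{G})$. Ensembles: given a finite set $\mathcal{G}$ of graphs, a vector-valued function $\vec C$ on $\mathcal{G}$ and a value $\vec C^*$ attained by $\vec C$ for at least one graph in $\mathcal{G}$, the microcanonical distribution is $P_{\mathrm{mic}}(\mathbf{G})=1/\Omega_{\vec C^*}$ if $\vec C(\mathbf{G})=\vec C^*$ and $0$ otherwise, where $\Omega_{\vec C^*}=|\{\mathbf{G}\in\mathcal{G}\colon\vec C(\mathbf{G})=\vec C^*\}|$. The canonical distribution $P_{\mathrm{can}}$ is the probability distribution on $\mathcal{G}$ that maximises the entropy $-\sum_{\mathbf{G}\in\mathcal{G}}P(\mathbf{G})\ln P(\mathbf{G})$ subject to $\sum_{\mathbf{G}\in\mathcal{G}}P(\mathbf{G})\,\vec C(\mathbf{G})=\vec C^*$; it has the form $P_{\mathrm{can}}(\mathbf{G})=e^{-\vec\theta^*\cdot\vec C(\mathbf{G})}/Z(\vec\theta^* )$ with $Z(\vec\theta)=\sum_{\mathbf{G}\in\mathcal{G}}e^{-\vec\theta\cdot\vec C(\mathbf{G})}$ and $\vec\theta^*$ chosen such that the average of $\vec C$ equals $\vec C^*$. The relative entropy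 is $S_n(P_{\mathrm{mic}}\mid P_{\mathrm{can}})=\sum_{\mathbf{G}\in\mathcal{G}}P_{\mathrm{mic}}(\mathbf{G})\ln\frac{P_{\mathrm{mic}}(\mathbf{G})}{P_{\mathrm{can}}(\mathbf{G})}$. The function $g\colon\mathbb{N}_0\to[0,\infty)$ is $g(k)=\log\left(\frac{k!}{k^ke^{-k}}\right)$ (so $g(0)=0$), and $\|h\|_{\ell^1(g)}=\sum_{k\in\mathbb{N}_0}|h(k)|\,g(k)$.
   Formalization: The formal theorem additionally assumes that f is not the point measure δ_0; for f = δ_0 (e.g. all k_i^* = 0) one has ‖f‖_{ℓ^1(g)} = g(0) = 0, so the claimed strict positivity fails. *)

theory Defs
  imports "HOL-Probability.Probability" "HOL-Library.Landau_Symbols"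
begin

subsection \<open>Simple graphs on the nodes \<open>1, \<dots>, n\<close>\<close>

text \<open>A simple undirected graph is given by its set of links, each link being an unordered pair of
  distinct nodes.\<close>

definition simple_graphs :: "nat \<Rightarrow> nat set set set" where
  "simple_graphs n = Pow {e. e \<subseteq> {1..n} \<and> card e = 2}"

definition adj :: "nat set set \<Rightarrow> nat \<Rightarrow> nat \<Rightarrow> nat" where
  "adj G i j = of_bool ({i, j} \<in> G)"

definition node_degree :: "nat \<Rightarrow> nat set set \<Rightarrow> nat \<Rightarrow> nat" where
  "node_degree n G i = (\<Sum>j\<in>{1..n} - {i}. adj G i j)"

definition graphical :: "nat \<Rightarrow> (nat \<Rightarrow> nat) \<Rightarrow> bool" where
  "graphical n k \<longleftrightarrow> (\<exists>G\<in>simple_graphs n. \<forall>i\<in>{1..n}. node_degree n G i = k i)"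

subsection \<open>Ensembles\<close>

text \<open>Here \<open>\<G>\<close> is a finite set, the vector-valued function \<open>C\<close> has components \<open>\<lambda>x. C x i\<close> for
  \<open>i \<in> I\<close>, and \<open>c\<close> is a value attained by \<open>C\<close> on \<open>\<G>\<close>.\<close>

definition microcanonical ::
    "'g set \<Rightarrow> 'i set \<Rightarrow> ('g \<Rightarrow> 'i \<Rightarrow> real) \<Rightarrow> ('i \<Rightarrow> real) \<Rightarrow> 'g pmf" where
  "microcanonical \<G> I C c = pmf_of_set {x \<in> \<G>. \<forall>i\<in>I. C x i = c i}"

text \<open>Since \<open>ln 0 = 0\<close>, the convention \<open>0 ln 0 = 0\<close> is built in.\<close>

definition shannon_entropy :: "'g set \<Rightarrow> 'g pmf \<Rightarrow> real" where
  "shannon_entropy \<G> P = - (\<Sum>x\<in>\<G>. pmf P x * ln (pmf P x))"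

definition soft_constraint ::
    "'g set \<Rightarrow> 'i set \<Rightarrow> ('g \<Rightarrow> 'i \<Rightarrow> real) \<Rightarrow> ('i \<Rightarrow> real) \<Rightarrow> 'g pmf \<Rightarrow> bool" where
  "soft_constraint \<G> I C c P \<longleftrightarrow>
     set_pmf P \<subseteq> \<G> \<and> (\<forall>i\<in>I. (\<Sum>x\<in>\<G>. pmf P x * C x i) = c i)"

text \<open>The canonical ensemble is the entropy maximiser, which exists by compactness and is unique by
  strict concavity of the entropy. It is defined variationally rather than by its Gibbs form
  \<open>exp (- \<theta> \<bullet> C x) / Z \<theta>\<close>, because for \<open>c\<close> on the boundary of the convex hull of \<open>C ` \<G>\<close>
  (for instance, a degree sequence with a zero entry) no finite \<open>\<theta>\<close> exists.\<close>

definition canonical ::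
    "'g set \<Rightarrow> 'i set \<Rightarrow> ('g \<Rightarrow> 'i \<Rightarrow> real) \<Rightarrow> ('i \<Rightarrow> real) \<Rightarrow> 'g pmf" where
  "canonical \<G> I C c = arg_max (shannon_entropy \<G>) (soft_constraint \<G> I C c)"

text \<open>The real-valued quotient is harmless for \<open>P\<close> microcanonical and \<open>Q\<close> canonical: the entropy
  maximiser charges every point charged by some distribution satisfying the soft constraint,
  so \<open>pmf Q x = 0\<close> implies \<open>pmf P x = 0\<close>.\<close>

definition relative_entropy :: "'g set \<Rightarrow> 'g pmf \<Rightarrow> 'g pmf \<Rightarrow> real" where
  "relative_entropy \<G> P Q = (\<Sum>x\<in>\<G>. pmf P x * ln (pmf P x / pmf Q x))"

definition P_mic :: "nat \<Rightarrow> (nat \<Rightarrow> nat) \<Rightarrow> nat set set pmf" where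
  "P_mic n k = microcanonical (simple_graphs n) {1..n} (\<lambda>G i. real (node_degree n G i)) (\<lambda>i. real (k i))"

definition P_can :: "nat \<Rightarrow> (nat \<Rightarrow> nat) \<Rightarrow> nat set set pmf" where
  "P_can n k = canonical (simple_graphs n) {1..n} (\<lambda>G i. real (node_degree n G i)) (\<lambda>i. real (k i))"

subsection \<open>Empirical degree distribution and the weighted \<open>\<ell>\<^sup>1\<close> norm\<close>

definition empirical :: "nat \<Rightarrow> (nat \<Rightarrow> nat) \<Rightarrow> nat \<Rightarrow> real" where
  "empirical n k j = (\<Sum>i=1..n. of_bool (k i = j)) / real n"

definition g_weight :: "nat \<Rightarrow> real" where
  "g_weight k = ln (fact k / (real k ^ k * exp (- real k)))"

text \<open>The norm takes values in \<open>[0, \<infinity>]\<close>; note that \<open>g_weight \<ge> 0\<close>, so \<open>ennreal\<close> truncates nothing.\<close>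

definition l1g_norm :: "(nat \<Rightarrow> real) \<Rightarrow> ennreal" where
  "l1g_norm h = (\<Sum>k. ennreal (\<bar>h k\<bar> * g_weight k))"

end

theory Submission
  imports Defs "HOL-Combinatorics.Multiset_Permutations" "HOL-Real_Asymp.Real_Asymp"
begin

text \<open>Write \<open>N = \<Sum>i. k i = 2 * L\<close> and \<open>K = Max k\<close>. Stationarity of the entropy maximiser along the segment towards
  \<open>P_mic\<close> gives \<open>S = H(P_can) - ln \<Omega>\<close>, where \<open>\<Omega>\<close> counts the graphs with degree sequence \<open>k\<close>. Both
  terms are computed up to an error \<open>O(K\<^sup>2 + ln N)\<close>, which is \<open>o(n)\<close> in the sparse regime.

  The entropy \<open>H(P_can)\<close> is \<open>L * ln N + L - (\<Sum>i. k i * ln (k i))\<close> up to \<open>O(K\<^sup>2)\<close>: Gibbs' inequality with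
  independent links of odds \<open>k i * k j / N\<close> bounds it from above, and an explicit product measure with
  exactly the right expected degrees bounds it from below.

  For \<open>\<Omega>\<close>, pair up the half-links at random (configuration model). Then
  \<open>\<Omega> * 2 ^ L * L! * (\<Prod>i. k i!) = N! * p\<close>, where \<open>p\<close> is the probability that the pairing has neither
  loops nor multiple links. Trivially \<open>p \<le> 1\<close>, and the lopsided local lemma gives \<open>p \<ge> exp (- 80 * K\<^sup>2)\<close>.
  Stirling's formula turns the difference into \<open>\<Sum>i. g_weight (k i)\<close>.\<close>

section \<open>The lopsided local lemma for random permutations\<close>

text \<open>Only logarithms up to o(n) matter, and this decides the means. When K grows, the
  probability p may itself decay with K, so arguments that need it near 1 are of no use. The local
  lemma has the right shape: its bound is the exponential of minus a multiple of the total weight of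
  the bad events, which is O(K^2). If some degree is 0, finite Gibbs parameters need not exist, so
  the canonical ensemble is reached only through its maximality: a competitor with exactly the
  prescribed mean degrees bounds its entropy from below. Plain Chung-Lu links do not qualify,
  because a node is not its own neighbour and its mean degree falls short; this forces the
  correction of the weights. \<open>g_weight\<close> is the exact remainder in Stirling's formula,
  so the factorials of the degrees bring in no error at all; only the remainders for L! and (2L)!
  are left over, and they are O(ln N). The finite estimate needs N to be large compared with K^2. In
  the limit this comes from \<open>g_weight m \<le> m\<close> and the positive limit of the averaged
  weights, which make N grow at least linearly in n.\<close>

definition avoiding :: "'s set \<Rightarrow> ('s \<Rightarrow> 'e \<Rightarrow> bool) \<Rightarrow> 'e set \<Rightarrow> 's set" where
  "avoiding \<Omega> occ S = {\<sigma> \<in> \<Omega>. \<forall>F\<in>S. \<not> occ \<sigma> F}"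

lemma finite_avoiding: "finite \<Omega> \<Longrightarrow> finite (avoiding \<Omega> occ S)"
  by (simp add: avoiding_def)

lemma avoiding_antimono: "S \<subseteq> T \<Longrightarrow> avoiding \<Omega> occ T \<subseteq> avoiding \<Omega> occ S"
  by (auto simp: avoiding_def)

text \<open>A counting form of the lopsided local lemma. Events on permutations are not independent
  even without a conflict, so \<open>indep\<close> asks only for a one-sided bound on the
  conditional probability. With the thresholds 1/4, conditioning on conflicting events as well at
  most doubles that bound.\<close>

locale lopsided =
  fixes \<Omega> :: "'s set" and occ :: "'s \<Rightarrow> 'e \<Rightarrow> bool" and \<B> :: "'e set"
    and conflict :: "'e \<Rightarrow> 'e \<Rightarrow> bool" and q :: "'e \<Rightarrow> real"
  assumes fin: "finite \<Omega>" "finite \<B>"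
    and q_nonneg: "\<And>A. A \<in> \<B> \<Longrightarrow> 0 \<le> q A"
    and q_le: "\<And>A. A \<in> \<B> \<Longrightarrow> q A \<le> 1 / 4"
    and indep: "\<And>A S. A \<in> \<B> \<Longrightarrow> S \<subseteq> \<B> \<Longrightarrow> \<forall>F\<in>S. \<not> conflict A F \<Longrightarrow>
      real (card {\<sigma> \<in> avoiding \<Omega> occ S. occ \<sigma> A}) \<le> q A * real (card (avoiding \<Omega> occ S))"
    and conflict_sum: "\<And>A. A \<in> \<B> \<Longrightarrow> (\<Sum>F | F \<in> \<B> \<and> conflict A F. q F) \<le> 1 / 4"
begin

text \<open>Dropping the conditions in conflict with \<open>A\<close> leaves \<open>S2\<close> and
  enlarges the left side to at most \<open>q A\<close> times the count for \<open>S2\<close>. By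
  induction, given \<open>S2\<close>, the dropped events remove at most the share 2 * 1/4 of that
  count, so restoring them loses at most half.\<close>

lemma conditional_le:
  assumes "A \<in> \<B>" "S \<subseteq> \<B>"
  shows "real (card {\<sigma> \<in> avoiding \<Omega> occ S. occ \<sigma> A}) \<le> 2 * q A * real (card (avoiding \<Omega> occ S))"
  using assms
proof (induction "card S" arbitrary: A S rule: less_induct)
  case less
  define S1 where "S1 = {F \<in> S. conflict A F}"
  define S2 where "S2 = S - S1"
  have finS: "finite S" using less.prems fin finite_subset by blast
  have S2: "S2 \<subseteq> \<B>" "S2 \<subseteq> S" using less.prems by (auto simp: S2_def)
  let ?n = "\<lambda>T. real (card (avoiding \<Omega> occ T))"
  let ?c = "\<lambda>F T. real (card {\<sigma> \<in> avoiding \<Omega> occ T. occ \<sigma> F})"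
  have "?c A S \<le> ?c A S2"
    using avoiding_antimono[OF S2(2), of \<Omega> occ] finite_avoiding[OF fin(1), of occ S2]
    by (auto intro!: card_mono)
  also have "\<dots> \<le> q A * ?n S2"
    using less.prems S2 by (intro indep) (auto simp: S1_def S2_def)
  finally have 1: "?c A S \<le> q A * ?n S2" .
  have half: "?n S2 \<le> 2 * ?n S"
  proof (cases "S1 = {}")
    case True
    then show ?thesis by (simp add: S2_def)
  next
    case False
    then have less': "card S2 < card S"
      using finS by (intro psubset_card_mono) (auto simp: S2_def S1_def)
    have "avoiding \<Omega> occ S2 \<subseteq> avoiding \<Omega> occ S \<union> (\<Union>F\<in>S1. {\<sigma> \<in> avoiding \<Omega> occ S2. occ \<sigma> F})"
      by (auto simp: avoiding_def S2_def)
    then have "card (avoiding \<Omega> occ S2)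
      \<le> card (avoiding \<Omega> occ S \<union> (\<Union>F\<in>S1. {\<sigma> \<in> avoiding \<Omega> occ S2. occ \<sigma> F}))"
      using finS finite_avoiding[OF fin(1)] by (intro card_mono) (auto simp: S1_def)
    also have "\<dots> \<le> card (avoiding \<Omega> occ S) + card (\<Union>F\<in>S1. {\<sigma> \<in> avoiding \<Omega> occ S2. occ \<sigma> F})"
      by (rule card_Un_le)
    also have "\<dots> \<le> card (avoiding \<Omega> occ S) + (\<Sum>F\<in>S1. card {\<sigma> \<in> avoiding \<Omega> occ S2. occ \<sigma> F})"
      using finS by (intro add_left_mono card_UN_le) (auto simp: S1_def)
    finally have "?n S2 \<le> ?n S + (\<Sum>F\<in>S1. ?c F S2)"
      by (metis (no_types, lifting) of_nat_add of_nat_le_iff of_nat_sum sum.cong)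
    also have "(\<Sum>F\<in>S1. ?c F S2) \<le> (\<Sum>F\<in>S1. 2 * q F * ?n S2)"
      using less.hyps[OF less'] less.prems S2 by (intro sum_mono) (auto simp: S1_def)
    also have "\<dots> = 2 * (\<Sum>F\<in>S1. q F) * ?n S2"
      by (simp add: sum_distrib_left sum_distrib_right)
    also have "\<dots> \<le> 2 * (1 / 4) * ?n S2"
    proof -
      have "(\<Sum>F\<in>S1. q F) \<le> (\<Sum>F | F \<in> \<B> \<and> conflict A F. q F)"
        using less.prems fin q_nonneg by (intro sum_mono2) (auto simp: S1_def)
      also have "\<dots> \<le> 1 / 4" using less.prems conflict_sum by blast
      finally show ?thesis by (intro mult_right_mono) auto
    qed
    finally show ?thesis by simp
  qed
  have "q A * ?n S2 \<le> q A * (2 * ?n S)"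
    using half q_nonneg less.prems by (intro mult_left_mono) auto
  with 1 show ?case by simp
qed

text \<open>Chain rule: the events are forbidden one after another. Each keeps at least the fraction
  \<open>1 - 2 * q A\<close>, which is at least \<open>exp (- 4 * q A)\<close> because
  \<open>2 * q A \<le> 1 / 2\<close>.\<close>

theorem card_avoiding_ge:
  "exp (- 4 * (\<Sum>A\<in>\<B>. q A)) * real (card \<Omega>) \<le> real (card (avoiding \<Omega> occ \<B>))"
proof -
  have "S \<subseteq> \<B> \<Longrightarrow> exp (- 4 * (\<Sum>A\<in>S. q A)) * real (card \<Omega>) \<le> real (card (avoiding \<Omega> occ S))"
    if "finite S" for S
    using that
  proof (induction S)
    case empty
    then show ?case by (simp add: avoiding_def)
  next
    case (insert A S)
    let ?n = "\<lambda>T. real (card (avoiding \<Omega> occ T))"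
    have A: "A \<in> \<B>" "S \<subseteq> \<B>" using insert by auto
    have "avoiding \<Omega> occ S = avoiding \<Omega> occ (insert A S) \<union> {\<sigma> \<in> avoiding \<Omega> occ S. occ \<sigma> A}"
      by (auto simp: avoiding_def)
    then have "card (avoiding \<Omega> occ S) \<le> card (avoiding \<Omega> occ (insert A S))
        + card {\<sigma> \<in> avoiding \<Omega> occ S. occ \<sigma> A}"
      by (metis (no_types, lifting) card_Un_le)
    then have "?n S \<le> ?n (insert A S) + 2 * q A * ?n S"
      using conditional_le[OF A] by linarith
    then have "(1 - 2 * q A) * ?n S \<le> ?n (insert A S)" by (simp add: algebra_simps)
    moreover have "exp (- 4 * q A) \<le> 1 - 2 * q A"
    proof -
      have "- (2 * q A) - 2 * (2 * q A)\<^sup>2 \<le> ln (1 - 2 * q A)"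
        using q_nonneg[OF A(1)] q_le[OF A(1)] by (intro ln_one_minus_pos_lower_bound) auto
      moreover have "2 * (2 * q A)\<^sup>2 \<le> 2 * q A"
        using mult_left_mono[OF q_le[OF A(1)] q_nonneg[OF A(1)]] by (simp add: power2_eq_square)
      ultimately have "- 4 * q A \<le> ln (1 - 2 * q A)" by linarith
      then show ?thesis
        using q_le[OF A(1)] by (subst ln_ge_iff[symmetric]) auto
    qed
    ultimately have step: "exp (- 4 * q A) * ?n S \<le> ?n (insert A S)"
      by (meson mult_right_mono of_nat_0_le_iff order_trans)
    have "exp (- 4 * (\<Sum>A\<in>insert A S. q A)) = exp (- 4 * q A) * exp (- 4 * (\<Sum>A\<in>S. q A))"
      using insert by (simp add: exp_add[symmetric] algebra_simps)
    then have "exp (- 4 * (\<Sum>A\<in>insert A S. q A)) * real (card \<Omega>)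
        = exp (- 4 * q A) * (exp (- 4 * (\<Sum>A\<in>S. q A)) * real (card \<Omega>))" by simp
    also have "\<dots> \<le> exp (- 4 * q A) * ?n S"
      using insert.IH A by (intro mult_left_mono) auto
    also note step
    finally show ?case .
  qed
  from this[OF fin(2)] show ?thesis by simp
qed

end

section \<open>Switchings of permutations\<close>

definition extends :: "('a \<Rightarrow> 'a) \<Rightarrow> ('a \<times> 'a) set \<Rightarrow> bool" where
  "extends \<sigma> E \<longleftrightarrow> (\<forall>(p, v)\<in>E. \<sigma> p = v)"

text \<open>Sharing a position or a value counts as a conflict even when the two prescriptions agree
  there; every nonempty one conflicts with itself.\<close>

definition conflict :: "('a \<times> 'a) set \<Rightarrow> ('a \<times> 'a) set \<Rightarrow> bool" where
  "conflict A F \<longleftrightarrow> fst ` A \<inter> fst ` F \<noteq> {} \<or> snd ` A \<inter> snd ` F \<noteq> {}"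

lemma permutation_extends_step:
  fixes X :: "'a set"
  assumes X: "finite X" and y: "y \<in> X" and x: "x \<notin> fst ` A" and A: "snd ` A \<subseteq> X" "y \<notin> snd ` A" "finite A" "inj_on snd A"
    and S: "\<forall>F\<in>S. \<not> conflict (insert (x, y) A) F"
  shows "card {\<sigma> \<in> avoiding {\<sigma>. \<sigma> permutes X} extends S. extends \<sigma> (insert (x, y) A)} * (card X - card A)
       \<le> card {\<sigma> \<in> avoiding {\<sigma>. \<sigma> permutes X} extends S. extends \<sigma> A}"
proof -
  let ?Av = "avoiding {\<sigma>. \<sigma> permutes X} extends S"
  let ?L = "{\<sigma> \<in> ?Av. extends \<sigma> (insert (x, y) A)}"
  let ?R = "{\<sigma> \<in> ?Av. extends \<sigma> A}"
  define Y where "Y = X - snd ` A"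
  have finR: "finite ?R" "finite ?L"
    using finite_avoiding[OF finite_permutations[OF X], of extends S] by simp_all
  have cardY: "card Y = card X - card A"
    using X A by (simp add: Y_def card_Diff_subset card_image)
  let ?f = "\<lambda>(\<sigma>, z). Transposition.transpose y z \<circ> \<sigma>"
  have inj: "inj_on ?f (?L \<times> Y)"
  proof (rule inj_onI, clarify)
    fix \<sigma> z \<sigma>' z'
    assume *: "extends \<sigma> (insert (x, y) A)" "extends \<sigma>' (insert (x, y) A)"
      and eq: "Transposition.transpose y z \<circ> \<sigma> = Transposition.transpose y z' \<circ> \<sigma>'"
    then have "\<sigma> x = y" "\<sigma>' x = y" by (auto simp: extends_def)
    with fun_cong[OF eq, of x] have "z = z'" by simp
    moreover from this eq have "\<sigma> = \<sigma>'"
      by (metis comp_assoc transpose_comp_involutory id_comp)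
    ultimately show "\<sigma> = \<sigma>' \<and> z = z'" by simp
  qed
  have img: "?f ` (?L \<times> Y) \<subseteq> ?R"
  proof clarify
    fix \<sigma> z
    assume \<sigma>: "\<sigma> \<in> ?Av" "extends \<sigma> (insert (x, y) A)" and z: "z \<in> Y"
    then have p: "\<sigma> permutes X" and av: "\<And>F. F \<in> S \<Longrightarrow> \<not> extends \<sigma> F" and sx: "\<sigma> x = y"
      by (auto simp: avoiding_def extends_def)
    have "Transposition.transpose y z \<circ> \<sigma> permutes X"
      using p y z by (intro permutes_compose permutes_swap_id) (auto simp: Y_def)
    moreover have "extends (Transposition.transpose y z \<circ> \<sigma>) A"
    proof -
      have "Transposition.transpose y z (\<sigma> a) = b" if "(a, b) \<in> A" for a b
      proof -
        have "\<sigma> a = b" using \<sigma>(2) that by (auto simp: extends_def)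
        moreover have "b \<noteq> y" "b \<noteq> z" using that z A(2) by (force simp: Y_def)+
        ultimately show ?thesis by simp
      qed
      then show ?thesis by (auto simp: extends_def)
    qed
    moreover have "\<not> extends (Transposition.transpose y z \<circ> \<sigma>) F" if F: "F \<in> S" for F
    proof
      assume ex: "extends (Transposition.transpose y z \<circ> \<sigma>) F"
      have nc: "x \<notin> fst ` F" "y \<notin> snd ` F" using S F by (auto simp: conflict_def)
      have "\<sigma> a = b" if ab: "(a, b) \<in> F" for a b
      proof -
        have t: "Transposition.transpose y z (\<sigma> a) = b" using ex ab by (auto simp: extends_def)
        have "b \<noteq> y" "a \<noteq> x" using nc ab by force+
        moreover have "b \<noteq> z"
        proof
          assume "b = z"
          with t have "\<sigma> a = y" by (metis transpose_involutory transpose_apply_second)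
          with sx have "a = x" using permutes_inj[OF p] by (metis injD)
          with \<open>a \<noteq> x\<close> show False ..
        qed
        ultimately show ?thesis using t by (metis transpose_apply_other transpose_involutory)
      qed
      then show False using av[OF F] by (auto simp: extends_def)
    qed
    ultimately show "Transposition.transpose y z \<circ> \<sigma> \<in> ?Av \<and> extends (Transposition.transpose y z \<circ> \<sigma>) A"
      by (auto simp: avoiding_def)
  qed
  have "card ?L * card Y = card (?f ` (?L \<times> Y))"
    using inj by (simp add: card_image card_cartesian_product)
  also have "\<dots> \<le> card ?R" using img finR by (intro card_mono)
  finally show ?thesis by (simp add: cardY)
qed

text \<open>The pairs of \<open>A\<close> are prescribed one at a time. A pair added to
  \<open>j\<close> earlier ones costs a factor \<open>1 / (card X - j)\<close>; the
  \<open>+ 2\<close> in the size condition keeps the last value, \<open>j = card A - 1\<close>, at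
  most half of \<open>card X\<close>.\<close>

lemma permutation_extends_le:
  fixes X :: "'a set"
  assumes X: "finite X" and A: "finite A" "snd ` A \<subseteq> X" "inj_on fst A" "inj_on snd A"
    and S: "\<forall>F\<in>S. \<not> conflict A F" and card: "2 * card A \<le> card X + 2"
  shows "real (card {\<sigma> \<in> avoiding {\<sigma>. \<sigma> permutes X} extends S. extends \<sigma> A})
       \<le> (2 / real (card X)) ^ card A * real (card (avoiding {\<sigma>. \<sigma> permutes X} extends S))"
  using A S card
proof (induction A)
  case empty
  then show ?case by (simp add: extends_def)
next
  case (insert e A)
  obtain x y where e: "e = (x, y)" by force
  let ?Av = "avoiding {\<sigma>. \<sigma> permutes X} extends S"
  let ?c = "\<lambda>A. real (card {\<sigma> \<in> ?Av. extends \<sigma> A})"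
  let ?N = "real (card X)"
  have "y \<in> X" using insert e by auto
  then have N0: "?N > 0" using X card_gt_0_iff by fastforce
  have notin: "x \<notin> fst ` A" "y \<notin> snd ` A"
    using insert.prems(2,3) insert.hyps(2) by (simp_all add: e)
  have "?c (insert e A) * (?N - real (card A)) = real (card {\<sigma> \<in> ?Av. extends \<sigma> (insert e A)} * (card X - card A))"
    using insert by (simp add: of_nat_diff)
  also have "\<dots> \<le> ?c A"
    unfolding e of_nat_le_iff using insert notin \<open>y \<in> X\<close> X e by (intro permutation_extends_step) auto
  finally have 1: "?c (insert e A) * (?N - real (card A)) \<le> ?c A" .
  have "?c (insert e A) * (?N / 2) \<le> ?c (insert e A) * (?N - real (card A))"
    using insert by (intro mult_left_mono) auto
  with 1 have "?c (insert e A) * (?N / 2) \<le> ?c A" by linarith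
  then have "?c (insert e A) \<le> 2 / ?N * ?c A" using N0 by (simp add: field_simps)
  also have "\<dots> \<le> 2 / ?N * ((2 / ?N) ^ card A * real (card ?Av))"
  proof (intro mult_left_mono insert.IH)
    show "\<forall>F\<in>S. \<not> conflict A F" using insert.prems by (auto simp: conflict_def)
  qed (use insert N0 in auto)
  finally show ?case using insert by (simp add: mult_ac)
qed

section \<open>Words and degree sequences\<close>

text \<open>A word is a pairing of half-links, each written as the name of its node: positions
  \<open>2 * t\<close> and \<open>2 * t + 1\<close> form one link, and a loop shows up as a
  singleton.\<close>

fun pairs :: "'a list \<Rightarrow> 'a set list" where
  "pairs (a # b # ws) = {a, b} # pairs ws"
| "pairs ws = []"

text \<open>The length clause excludes words with an odd last letter, which \<open>pairs\<close>
  would ignore.\<close>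

definition enumerations :: "'a set set \<Rightarrow> 'a list set" where
  "enumerations G = {ws. length ws = 2 * card G \<and> distinct (pairs ws) \<and> set (pairs ws) = G}"

definition proper :: "'a list \<Rightarrow> bool" where
  "proper ws \<longleftrightarrow> distinct (pairs ws) \<and> (\<forall>e\<in>set (pairs ws). card e = 2)"

lemma length_pairs: "length (pairs ws) = length ws div 2"
  by (induction ws rule: pairs.induct) auto

lemma pairs_append: "even (length xs) \<Longrightarrow> pairs (xs @ ys) = pairs xs @ pairs ys"
  by (induction xs rule: pairs.induct) auto

lemma pairs_map_upt: "pairs (map g [0..<2 * L]) = map (\<lambda>t. {g (2 * t), g (2 * t + 1)}) [0..<L]"
  by (induction L) (auto simp: pairs_append)

lemma enumerations_finite:
  assumes "finite G" "\<forall>e\<in>G. card e = 2"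
  shows "finite (enumerations G)"
proof -
  have sub: "set ws \<subseteq> \<Union> (set (pairs ws))" if "even (length ws)" for ws :: "'a list"
    using that by (induction ws rule: pairs.induct) auto
  have "enumerations G \<subseteq> {ws. set ws \<subseteq> \<Union> G \<and> length ws = 2 * card G}"
  proof (intro subsetI CollectI conjI)
    fix ws x assume "ws \<in> enumerations G" "x \<in> set ws"
    then show "x \<in> \<Union> G" using sub[of ws] by (auto simp: enumerations_def)
  qed (simp add: enumerations_def)
  moreover have "finite (\<Union> G)"
    using assms by (intro finite_Union) (auto intro: card_ge_0_finite)
  ultimately show ?thesis by (rule finite_subset[OF _ finite_lists_length_eq])
qed

text \<open>The first link can be any of the \<open>card G\<close> links in either orientation; the
  rest of the word enumerates \<open>G - {e}\<close>.\<close>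

lemma card_enumerations:
  assumes "finite G" "\<forall>e\<in>G. card e = 2"
  shows "card (enumerations G) = 2 ^ card G * fact (card G)"
  using assms
proof (induction "card G" arbitrary: G)
  case 0
  then have "enumerations G = {[]}" by (auto simp: enumerations_def)
  with 0 show ?case by simp
next
  case (Suc m)
  let ?O = "\<lambda>e. {(a, b). {a, b} = e}"
  let ?I = "\<lambda>e. (\<lambda>((a, b), ws). a # b # ws) ` (?O e \<times> enumerations (G - {e}))"
  have O: "finite (?O e) \<and> card (?O e) = 2" if e: "e \<in> G" for e
  proof -
    obtain a b where "e = {a, b}" "a \<noteq> b" using Suc.prems e by (metis card_2_iff)
    then have "?O e = {(a, b), (b, a)}" by (auto simp: doubleton_eq_iff)
    then show ?thesis using \<open>a \<noteq> b\<close> by simp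
  qed
  have eq: "enumerations G = (\<Union>e\<in>G. ?I e)"
  proof (intro equalityI subsetI)
    fix ws assume ws: "ws \<in> enumerations G"
    then have "length ws = 2 * Suc m" using Suc.hyps(2) by (simp add: enumerations_def)
    then obtain a b vs where vs: "ws = a # b # vs" by (auto simp: length_Suc_conv)
    have "{a, b} \<in> G" "vs \<in> enumerations (G - {{a, b}})"
      using ws Suc.prems by (auto simp: enumerations_def vs)
    then have "ws \<in> ?I {a, b}" by (force simp: vs)
    then show "ws \<in> (\<Union>e\<in>G. ?I e)" using \<open>{a, b} \<in> G\<close> by blast
  next
    fix ws assume "ws \<in> (\<Union>e\<in>G. ?I e)"
    then obtain a b vs where "{a, b} \<in> G" "vs \<in> enumerations (G - {{a, b}})" "ws = a # b # vs" by auto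
    then show "ws \<in> enumerations G"
      using Suc.prems Suc.hyps(2) by (auto simp: enumerations_def)
  qed
  have card_I: "card (?I e) = 2 * (2 ^ m * fact m)" if e: "e \<in> G" for e
  proof -
    have "inj_on (\<lambda>((a, b), ws). a # b # ws) (?O e \<times> enumerations (G - {e}))"
      by (auto simp: inj_on_def)
    then have "card (?I e) = card (?O e) * card (enumerations (G - {e}))"
      by (simp add: card_image card_cartesian_product)
    moreover have "card (enumerations (G - {e})) = 2 ^ m * fact m"
      using Suc.hyps(1)[of "G - {e}"] Suc.hyps(2)[symmetric] Suc.prems e by simp
    ultimately show ?thesis using O[OF e] by simp
  qed
  have "card (enumerations G) = (\<Sum>e\<in>G. card (?I e))"
    unfolding eq
  proof (rule card_UN_disjoint)
    show "\<forall>e\<in>G. finite (?I e)"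
      using O Suc.prems by (intro ballI finite_imageI finite_cartesian_product enumerations_finite) auto
    show "\<forall>e\<in>G. \<forall>e'\<in>G. e \<noteq> e' \<longrightarrow> ?I e \<inter> ?I e' = {}" by auto
  qed (use Suc in auto)
  also have "\<dots> = Suc m * (2 * (2 ^ m * fact m))" using card_I Suc.hyps(2) by simp
  finally show ?case using Suc.hyps(2)[symmetric] by (simp add: algebra_simps)
qed

lemma count_pairs:
  assumes "even (length ws)" "\<forall>e\<in>set (pairs ws). card e = 2"
  shows "count (mset ws) i = length (filter (\<lambda>e. i \<in> e) (pairs ws))"
  using assms by (induction ws rule: pairs.induct) (auto simp: card_insert_if split: if_splits)

lemma count_proper:
  assumes "even (length ws)" "proper ws"
  shows "count (mset ws) i = card {e \<in> set (pairs ws). i \<in> e}"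
  using assms count_pairs[of ws i] distinct_card[of "filter (\<lambda>e. i \<in> e) (pairs ws)"]
  by (simp add: proper_def)

text \<open>A degree sequence is coded as a multiset so that its arrangements are words: a node of
  degree d is a letter of multiplicity d. Nodes outside \<open>M\<close> are forced to be
  isolated.\<close>

definition realizations :: "'a multiset \<Rightarrow> 'a set set set" where
  "realizations M = {G. finite G \<and> (\<forall>e\<in>G. card e = 2) \<and> (\<forall>i. card {e \<in> G. i \<in> e} = count M i)}"

lemma enumeration_realization:
  assumes G: "G \<in> realizations M" and ws: "ws \<in> enumerations G"
  shows "mset ws = M"
proof (rule multiset_eqI)
  fix i
  show "count (mset ws) i = count M i"
    using assms count_proper[of ws i] by (auto simp: realizations_def enumerations_def proper_def)
qed

text \<open>The handshake identity, read off from the length of any enumeration of \<open>G\<close>;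
  there is one because their number is nonzero.\<close>

lemma card_realization:
  assumes G: "G \<in> realizations M"
  shows "2 * card G = size M"
proof -
  have "card (enumerations G) \<noteq> 0"
    using card_enumerations[of G] G by (simp add: realizations_def)
  then obtain ws where ws: "ws \<in> enumerations G" by fastforce
  then show ?thesis
    using enumeration_realization[OF G ws] by (metis (mono_tags, lifting) enumerations_def mem_Collect_eq size_mset)
qed

lemma finite_realizations: "finite (realizations M)"
proof -
  have "realizations M \<subseteq> Pow (Pow (set_mset M))"
  proof (clarsimp simp: realizations_def)
    fix G e i
    assume *: "finite G" "\<forall>i. card {e \<in> G. i \<in> e} = count M i" "e \<in> G" "i \<in> e"
    have "{e \<in> G. i \<in> e} \<noteq> {}" "finite {e \<in> G. i \<in> e}" using * by auto
    then have "count M i \<noteq> 0" using * by (metis card_0_eq)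
    then show "i \<in># M" by simp
  qed
  then show ?thesis by (rule finite_subset) simp
qed

text \<open>Proper words fall into classes according to the graph they enumerate, and by
  \<open>card_enumerations\<close> all classes have the same size.\<close>

lemma card_proper_words:
  assumes M: "size M = 2 * L"
  shows "card {ws \<in> permutations_of_multiset M. proper ws} = card (realizations M) * (2 ^ L * fact L)"
proof -
  have card_G: "card G = L" if "G \<in> realizations M" for G
    using card_realization[OF that] M by simp
  have "{ws \<in> permutations_of_multiset M. proper ws} = (\<Union>G\<in>realizations M. enumerations G)"
  proof (intro equalityI subsetI)
    fix ws assume "ws \<in> {ws \<in> permutations_of_multiset M. proper ws}"
    then have ws: "mset ws = M" "proper ws" by (auto simp: permutations_of_multiset_def)
    then have len: "length ws = 2 * L" using M by (metis size_mset)
    have "set (pairs ws) \<in> realizations M"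
      using ws len count_proper[of ws] by (auto simp: realizations_def proper_def)
    moreover have "ws \<in> enumerations (set (pairs ws))"
      using ws len by (simp add: enumerations_def proper_def distinct_card length_pairs)
    ultimately show "ws \<in> (\<Union>G\<in>realizations M. enumerations G)" by blast
  next
    fix ws assume "ws \<in> (\<Union>G\<in>realizations M. enumerations G)"
    then obtain G where G: "G \<in> realizations M" "ws \<in> enumerations G" by blast
    then show "ws \<in> {ws \<in> permutations_of_multiset M. proper ws}"
      using enumeration_realization[OF G]
      by (auto simp: permutations_of_multiset_def enumerations_def proper_def realizations_def)
  qed
  also have "card \<dots> = (\<Sum>G\<in>realizations M. card (enumerations G))"
    by (rule card_UN_disjoint[OF finite_realizations])
      (use enumerations_finite in \<open>auto simp: realizations_def, auto simp: enumerations_def\<close>)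
  also have "\<dots> = (\<Sum>G\<in>realizations M. 2 ^ L * fact L)"
    by (intro sum.cong refl, subst card_enumerations) (auto simp: card_G, auto simp: realizations_def)
  finally show ?thesis by simp
qed

text \<open>The fibres of the map from \<sigma> to \<open>permute_list \<sigma> xs\<close> are
  cosets of the stabiliser of \<open>xs\<close>, hence equally large. A uniform permutation thus
  induces a uniform word, which lets the local lemma for permutations speak about words.\<close>

lemma card_permutations_words:
  fixes xs :: "'a list"
  defines "P \<equiv> {\<sigma>. \<sigma> permutes {..<length xs}}"
  shows "card {\<sigma> \<in> P. Q (permute_list \<sigma> xs)}
    = card {\<sigma> \<in> P. permute_list \<sigma> xs = xs} * card {ws \<in> permutations_of_multiset (mset xs). Q ws}"
proof -
  let ?fib = "\<lambda>ws. {\<sigma> \<in> P. permute_list \<sigma> xs = ws}"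
  let ?W = "{ws \<in> permutations_of_multiset (mset xs). Q ws}"
  have finP: "finite P" by (simp add: P_def finite_permutations)
  have fib: "card (?fib ws) = card (?fib xs)" if ws: "ws \<in> ?W" for ws
  proof -
    have "mset ws = mset xs" using ws by (simp add: permutations_of_multiset_def)
    then obtain p where p: "p permutes {..<length xs}" "permute_list p xs = ws"
      by (rule mset_eq_permutation)
    have "bij_betw (\<lambda>\<sigma>. \<sigma> \<circ> p) (?fib xs) (?fib ws)"
    proof (rule bij_betw_byWitness[where f' = "\<lambda>\<sigma>. \<sigma> \<circ> inv p"])
      show "\<forall>\<sigma>\<in>?fib xs. \<sigma> \<circ> p \<circ> inv p = \<sigma>"
        by (simp add: comp_assoc permutes_inv_o[OF p(1)])
      show "\<forall>\<sigma>\<in>?fib ws. \<sigma> \<circ> inv p \<circ> p = \<sigma>"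
        by (simp add: comp_assoc permutes_inv_o[OF p(1)])
      show "(\<lambda>\<sigma>. \<sigma> \<circ> p) ` ?fib xs \<subseteq> ?fib ws"
      proof clarify
        fix \<sigma> assume \<sigma>: "\<sigma> \<in> P" "permute_list \<sigma> xs = xs"
        then show "\<sigma> \<circ> p \<in> P \<and> permute_list (\<sigma> \<circ> p) xs = ws"
          using p permutes_compose[OF p(1), of \<sigma>] permute_list_compose[OF p(1), of \<sigma>] by (simp add: P_def)
      qed
      show "(\<lambda>\<sigma>. \<sigma> \<circ> inv p) ` ?fib ws \<subseteq> ?fib xs"
      proof clarify
        fix \<sigma> assume \<sigma>: "\<sigma> \<in> P" "ws = permute_list \<sigma> xs"
        have ip: "inv p permutes {..<length xs}" using p(1) by (rule permutes_inv)
        have "permute_list (\<sigma> \<circ> inv p) xs = permute_list (inv p) (permute_list p xs)"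
          using ip \<sigma> p(2) by (simp add: permute_list_compose)
        also have "\<dots> = permute_list (p \<circ> inv p) xs" using ip by (simp add: permute_list_compose)
        also have "\<dots> = xs" using permutes_inv_o[OF p(1)] by simp
        finally show "\<sigma> \<circ> inv p \<in> P \<and> permute_list (\<sigma> \<circ> inv p) xs = xs"
          using \<sigma> ip permutes_compose[OF ip, of \<sigma>] by (simp add: P_def)
      qed
    qed
    from bij_betw_same_card[OF this] show ?thesis by simp
  qed
  have "{\<sigma> \<in> P. Q (permute_list \<sigma> xs)} = (\<Union>ws\<in>?W. ?fib ws)"
    by (auto simp: P_def permutations_of_multiset_def)
  also have "card \<dots> = (\<Sum>ws\<in>?W. card (?fib ws))"
    using finP by (intro card_UN_disjoint) auto
  also have "\<dots> = (\<Sum>ws\<in>?W. card (?fib xs))" by (intro sum.cong refl fib)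
  finally show ?thesis by simp
qed

section \<open>Bad events: loops and double links\<close>

definition partner :: "nat \<Rightarrow> nat" where
  "partner p = (if even p then p + 1 else p - 1)"

lemma partner_partner [simp]: "partner (partner p) = p"
  by (auto simp: partner_def)

lemma partner_neq [simp]: "partner p \<noteq> p" "p \<noteq> partner p"
  by (auto simp: partner_def elim: oddE)

lemma partner_eq_iff [simp]: "partner p = partner q \<longleftrightarrow> p = q"
  by (metis partner_partner)

lemma partner_less: "p < 2 * L \<Longrightarrow> partner p < 2 * L"
  by (auto simp: partner_def elim!: evenE)

definition loop_event :: "nat \<Rightarrow> nat \<Rightarrow> nat \<Rightarrow> (nat \<times> nat) set" where
  "loop_event p a b = {(p, a), (partner p, b)}"

text \<open>The argument order \<open>a c b d\<close> puts half-links of the same node side by side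
  in \<open>doubles\<close>: \<open>a\<close> with \<open>c\<close>, and \<open>b\<close> with
  \<open>d\<close>.\<close>

definition double_event :: "nat \<Rightarrow> nat \<Rightarrow> nat \<Rightarrow> nat \<Rightarrow> nat \<Rightarrow> nat \<Rightarrow> (nat \<times> nat) set" where
  "double_event p q a c b d = {(p, a), (partner p, b), (q, c), (partner q, d)}"

definition loops :: "nat \<Rightarrow> (nat \<Rightarrow> 'a) \<Rightarrow> (nat \<times> nat) set set" where
  "loops N own = {loop_event p a b | p a b.
     p < N \<and> a < N \<and> b < N \<and> a \<noteq> b \<and> own b = own a}"

definition doubles :: "nat \<Rightarrow> (nat \<Rightarrow> 'a) \<Rightarrow> (nat \<times> nat) set set" where
  "doubles N own = {double_event p q a c b d | p q a c b d.
     p < N \<and> q < N \<and> p \<noteq> q \<and> p \<noteq> partner q \<and> a < N \<and> b < N \<and> c < N \<and> d < N \<and> distinct [a, b, c, d]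
     \<and> own c = own a \<and> own d = own b}"

lemma loop_event_swap: "loop_event (partner p) b a = loop_event p a b"
  by (auto simp: loop_event_def)

lemma double_event_swap:
  "double_event (partner p) (partner q) b d a c = double_event p q a c b d"
  "double_event q p c a d b = double_event p q a c b d"
  by (auto simp: double_event_def)

lemma loop_event_simps:
  assumes "a \<noteq> b"
  shows "card (loop_event p a b) = 2" "inj_on fst (loop_event p a b)" "inj_on snd (loop_event p a b)"
  using assms by (auto simp: loop_event_def)

lemma double_event_simps:
  assumes "p \<noteq> q" "p \<noteq> partner q" "distinct [a, b, c, d]"
  shows "card (double_event p q a c b d) = 4" "inj_on fst (double_event p q a c b d)"
    "inj_on snd (double_event p q a c b d)"
proof -
  have *: "partner p \<noteq> q" "q \<noteq> partner p" using assms by auto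
  show "card (double_event p q a c b d) = 4" "inj_on fst (double_event p q a c b d)"
    "inj_on snd (double_event p q a c b d)"
    using assms * by (auto simp: double_event_def card_insert_if)
qed

text \<open>Up to the symmetries of the events, one pair \<open>(p, a)\<close> of an event can be taken to be any of
  its pairs; this is why prescribing a position or a value costs a full factor \<open>N\<close>.\<close>

context
  fixes N L K :: nat and own :: "nat \<Rightarrow> 'a"
  assumes N: "N = 2 * L" and fiber: "\<And>y. card {v. v < N \<and> own v = y} \<le> K"
begin

definition same :: "(nat \<times> nat) set" where
  "same = Sigma {..<N} (\<lambda>a. {b. b < N \<and> own b = own a})"

lemma finite_same: "finite same" and card_same: "card same \<le> N * K"
proof -
  show "finite same" by (simp add: same_def)
  have "card same = (\<Sum>a<N. card {b. b < N \<and> own b = own a})"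
    by (simp add: same_def)
  also have "\<dots> \<le> N * K" using sum_bounded_above[of "{..<N}", OF fiber] by simp
  finally show "card same \<le> N * K" .
qed

lemma loops_subset: "loops N own \<subseteq> (\<lambda>(p, a, b). loop_event p a b) ` ({..<N} \<times> same)"
  by (force simp: loops_def same_def)

lemma doubles_subset:
  "doubles N own \<subseteq> (\<lambda>(p, q, (a, c), b, d). double_event p q a c b d) ` ({..<N} \<times> {..<N} \<times> same \<times> same)"
  by (force simp: doubles_def same_def)

lemma finite_loops: "finite (loops N own)" and card_loops: "card (loops N own) \<le> N * (N * K)"
proof -
  show "finite (loops N own)"
    by (rule finite_subset[OF loops_subset]) (simp add: finite_same)
  have "card (loops N own) \<le> card ({..<N} \<times> same)"
    by (rule surj_card_le[OF _ loops_subset]) (simp add: finite_same)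
  also have "\<dots> \<le> N * (N * K)" using card_same by (simp add: card_cartesian_product)
  finally show "card (loops N own) \<le> N * (N * K)" .
qed

lemma finite_doubles: "finite (doubles N own)"
  and card_doubles: "card (doubles N own) \<le> N * (N * ((N * K) * (N * K)))"
proof -
  show "finite (doubles N own)"
    by (rule finite_subset[OF doubles_subset]) (simp add: finite_same)
  have "card (doubles N own) \<le> card ({..<N} \<times> {..<N} \<times> same \<times> same)"
    by (rule surj_card_le[OF _ doubles_subset]) (simp add: finite_same)
  also have "\<dots> \<le> N * (N * ((N * K) * (N * K)))"
    using mult_le_mono[OF card_same card_same] by (simp add: card_cartesian_product)
  finally show "card (doubles N own) \<le> N * (N * ((N * K) * (N * K)))" .
qed

lemma card_loops_fst: "card {F \<in> loops N own. r \<in> fst ` F} \<le> N * K"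
proof -
  have "{F \<in> loops N own. r \<in> fst ` F} \<subseteq> (\<lambda>(a, b). loop_event r a b) ` same"
  proof clarify
    fix F e assume F: "F \<in> loops N own" "e \<in> F"
    then obtain p a b where *: "F = loop_event p a b" "a < N" "b < N" "own b = own a"
      by (auto simp: loops_def)
    then consider "fst e = p" | "fst e = partner p" using F by (auto simp: loop_event_def)
    then show "F \<in> (\<lambda>(a, b). loop_event (fst e) a b) ` same"
    proof cases
      case 1
      then show ?thesis using * by (intro image_eqI[of _ _ "(a, b)"]) (auto simp: same_def)
    next
      case 2
      then show ?thesis using * by (intro image_eqI[of _ _ "(b, a)"]) (auto simp: same_def loop_event_swap)
    qed
  qed
  from surj_card_le[OF finite_same this] show ?thesis using card_same by linarith
qed

lemma card_loops_snd: "card {F \<in> loops N own. v \<in> snd ` F} \<le> N * K"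
proof -
  let ?I = "{..<N} \<times> {b. b < N \<and> own b = own v}"
  have "{F \<in> loops N own. v \<in> snd ` F} \<subseteq> (\<lambda>(p, b). loop_event p v b) ` ?I"
  proof clarify
    fix F e assume F: "F \<in> loops N own" "e \<in> F"
    then obtain p a b where *: "F = loop_event p a b" "p < N" "a < N" "b < N" "own b = own a"
      by (auto simp: loops_def)
    have p: "partner p < N" using partner_less \<open>p < N\<close> N by simp
    consider "snd e = a" | "snd e = b" using F * by (auto simp: loop_event_def)
    then show "F \<in> (\<lambda>(p, b). loop_event p (snd e) b) ` ({..<N} \<times> {b. b < N \<and> own b = own (snd e)})"
    proof cases
      case 1
      then show ?thesis using * by (intro image_eqI[of _ _ "(p, b)"]) auto
    next
      case 2
      then show ?thesis using * p by (intro image_eqI[of _ _ "(partner p, a)"]) (auto simp: loop_event_swap)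
    qed
  qed
  from surj_card_le[OF _ this] have "card {F \<in> loops N own. v \<in> snd ` F} \<le> card ?I" by simp
  also have "\<dots> \<le> N * K" using fiber[of "own v"] by (simp add: card_cartesian_product)
  finally show ?thesis .
qed

lemma card_doubles_fst: "card {F \<in> doubles N own. r \<in> fst ` F} \<le> N * ((N * K) * (N * K))"
proof -
  let ?I = "{..<N} \<times> same \<times> same"
  let ?f = "\<lambda>r (q, (a, c), b, d). double_event r q a c b d"
  have "{F \<in> doubles N own. r \<in> fst ` F} \<subseteq> ?f r ` ?I"
  proof clarify
    fix F e assume F: "F \<in> doubles N own" "e \<in> F"
    then obtain p q a b c d where *: "F = double_event p q a c b d" "p < N" "q < N"
      "(a, c) \<in> same" "(b, d) \<in> same" "(c, a) \<in> same" "(d, b) \<in> same"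
      by (auto simp: doubles_def same_def)
    have pq: "partner p < N" "partner q < N" using partner_less * N by auto
    have "e \<in> {(p, a), (partner p, b), (q, c), (partner q, d)}"
      using F * by (simp add: double_event_def)
    then consider "fst e = p" | "fst e = partner p" | "fst e = q" | "fst e = partner q" by auto
    then show "F \<in> ?f (fst e) ` ?I"
    proof cases
      case 1
      then show ?thesis using * by (intro image_eqI[of _ _ "(q, (a, c), b, d)"]) auto
    next
      case 2
      then show ?thesis using * pq
        by (intro image_eqI[of _ _ "(partner q, (b, d), a, c)"]) (auto simp: double_event_swap(1))
    next
      case 3
      then show ?thesis using *
        by (intro image_eqI[of _ _ "(p, (c, a), d, b)"]) (auto simp: double_event_swap(2))
    next
      \<comment> \<open>Both symmetries are composed: exchanging the two links and exchanging the
        ends of each.\<close>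
      case 4
      then show ?thesis using * pq
        by (intro image_eqI[of _ _ "(partner p, (d, b), c, a)"])
          (auto simp: double_event_swap(1) double_event_swap(2)[of q p])
    qed
  qed
  from surj_card_le[OF _ this] have "card {F \<in> doubles N own. r \<in> fst ` F} \<le> card ?I"
    by (simp add: finite_same)
  also have "\<dots> \<le> N * ((N * K) * (N * K))"
    using mult_le_mono[OF card_same card_same] by (simp add: card_cartesian_product)
  finally show ?thesis .
qed

text \<open>Once the half-link \<open>v\<close> is given, its companion at the same node has at most
  \<open>K\<close> choices, so one factor \<open>N * K\<close> shrinks to \<open>K\<close>.\<close>

lemma card_doubles_snd: "card {F \<in> doubles N own. v \<in> snd ` F} \<le> N * ((N * K) * (N * K))"
proof -
  let ?I = "\<lambda>v. {..<N} \<times> {..<N} \<times> {c. c < N \<and> own c = own v} \<times> same"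
  let ?f = "\<lambda>v (p, q, c, b, d). double_event p q v c b d"
  have "{F \<in> doubles N own. v \<in> snd ` F} \<subseteq> ?f v ` ?I v"
  proof clarify
    fix F e assume F: "F \<in> doubles N own" "e \<in> F"
    then obtain p q a b c d where *: "F = double_event p q a c b d" "p < N" "q < N"
      "a < N" "b < N" "c < N" "d < N" "own c = own a" "own d = own b"
      "(a, c) \<in> same" "(b, d) \<in> same" "(c, a) \<in> same" "(d, b) \<in> same"
      by (auto simp: doubles_def same_def)
    have pq: "partner p < N" "partner q < N" using partner_less * N by auto
    have "e \<in> {(p, a), (partner p, b), (q, c), (partner q, d)}"
      using F * by (simp add: double_event_def)
    then consider "snd e = a" | "snd e = b" | "snd e = c" | "snd e = d" by auto
    then show "F \<in> ?f (snd e) ` ?I (snd e)"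
    proof cases
      case 1
      then show ?thesis using * by (intro image_eqI[of _ _ "(p, q, c, b, d)"]) auto
    next
      case 2
      then show ?thesis using * pq
        by (intro image_eqI[of _ _ "(partner p, partner q, d, a, c)"]) (auto simp: double_event_swap(1))
    next
      case 3
      then show ?thesis using *
        by (intro image_eqI[of _ _ "(q, p, a, d, b)"]) (auto simp: double_event_swap(2))
    next
      case 4
      then show ?thesis using * pq
        by (intro image_eqI[of _ _ "(partner q, partner p, b, c, a)"])
          (auto simp: double_event_swap(1) double_event_swap(2)[of q p])
    qed
  qed
  from surj_card_le[OF _ this] have "card {F \<in> doubles N own. v \<in> snd ` F} \<le> card (?I v)"
    by (simp add: finite_same)
  also have "\<dots> \<le> N * (N * (K * (N * K)))"
    using mult_le_mono[OF fiber card_same] by (simp add: card_cartesian_product)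
  also have "\<dots> = N * ((N * K) * (N * K))" by (simp add: mult_ac)
  finally show ?thesis .
qed

end

section \<open>Probability that a random pairing is simple\<close>

lemma sum_UNION_le:
  fixes q :: "'b \<Rightarrow> real"
  assumes "finite I" "\<And>i. i \<in> I \<Longrightarrow> finite (A i)" "\<And>x. 0 \<le> q x"
  shows "sum q (\<Union>i\<in>I. A i) \<le> (\<Sum>i\<in>I. sum q (A i))"
  using assms
proof (induction I)
  case (insert i I)
  have "sum q (A i \<union> (\<Union>i\<in>I. A i)) \<le> sum q (A i) + sum q (\<Union>i\<in>I. A i)"
    using insert.prems insert.hyps by (subst sum_Un) (auto simp: sum_nonneg)
  with insert show ?case by auto
qed simp

text \<open>Here \<open>xs ! \<sigma> i\<close> is the node whose half-link sits at position
  \<open>i\<close>. A word fails to be proper through one pair with equal ends or through two pairs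
  with the same ends; the values of \<sigma> at these positions then spell out a bad event.\<close>

lemma improper_permute_extends:
  assumes len: "length xs = 2 * L" and p: "\<sigma> permutes {..<2 * L}" and np: "\<not> proper (permute_list \<sigma> xs)"
  shows "\<exists>F \<in> loops (2 * L) ((!) xs) \<union> doubles (2 * L) ((!) xs). extends \<sigma> F"
proof -
  let ?N = "2 * L" and ?own = "(!) xs"
  let ?e = "\<lambda>t. {?own (\<sigma> (2 * t)), ?own (\<sigma> (2 * t + 1))}"
  have pl: "pairs (permute_list \<sigma> xs) = map ?e [0..<L]"
    by (simp add: permute_list_def len pairs_map_upt)
  have lt: "\<sigma> i < ?N" if "i < ?N" for i using permutes_in_image[OF p] that by auto
  have inj: "\<sigma> i = \<sigma> j \<longleftrightarrow> i = j" for i j using permutes_inj[OF p] by (meson injD)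
  consider t where "t < L" "card (?e t) \<noteq> 2" | t u where "t < L" "u < L" "t \<noteq> u" "?e t = ?e u"
    using np by (auto simp: proper_def pl distinct_map inj_on_def)
  then show ?thesis
  proof cases
    case (1 t)
    then have "?own (\<sigma> (2 * t)) = ?own (\<sigma> (2 * t + 1))" by (auto simp: card_insert_if split: if_splits)
    then have "loop_event (2 * t) (\<sigma> (2 * t)) (\<sigma> (2 * t + 1)) \<in> loops ?N ?own"
      unfolding loops_def using 1 lt[of "2 * t"] lt[of "2 * t + 1"] inj[of "2 * t" "2 * t + 1"]
      by (intro CollectI exI[of _ "2 * t"] exI[of _ "\<sigma> (2 * t)"] exI[of _ "\<sigma> (2 * t + 1)"]) auto
    moreover have "extends \<sigma> (loop_event (2 * t) (\<sigma> (2 * t)) (\<sigma> (2 * t + 1)))"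
      by (simp add: extends_def loop_event_def partner_def)
    ultimately show ?thesis by blast
  next
    case (2 t u)
    define p where "p = 2 * t"
    have main: ?thesis if q: "q < ?N" "q = 2 * u \<or> q = 2 * u + 1" and own: "?own (\<sigma> q) = ?own (\<sigma> p)"
      "?own (\<sigma> (partner q)) = ?own (\<sigma> (partner p))" for q
    proof -
      let ?F = "double_event p q (\<sigma> p) (\<sigma> q) (\<sigma> (partner p)) (\<sigma> (partner q))"
      have pq: "p < ?N" "p \<noteq> q" "p \<noteq> partner q" "partner p \<noteq> q"
        using 2 q by (auto simp: p_def partner_def)
      have "distinct [\<sigma> p, \<sigma> (partner p), \<sigma> q, \<sigma> (partner q)]"
        using pq by (simp add: inj)
      moreover have "\<sigma> p < ?N" "\<sigma> q < ?N" "\<sigma> (partner p) < ?N" "\<sigma> (partner q) < ?N"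
        using pq q by (auto intro!: lt partner_less)
      ultimately have "?F \<in> doubles ?N ?own"
        unfolding doubles_def using pq q own by blast
      moreover have "extends \<sigma> ?F" by (simp add: extends_def double_event_def)
      ultimately show ?thesis by blast
    qed
    \<comment> \<open>Equal doubletons match straight or crossed; in the crossed case
      \<open>q\<close> is the second position of pair \<open>u\<close>.\<close>
    from 2(4) consider "?own (\<sigma> (2 * u)) = ?own (\<sigma> p)" "?own (\<sigma> (2 * u + 1)) = ?own (\<sigma> (p + 1))"
      | "?own (\<sigma> (2 * u + 1)) = ?own (\<sigma> p)" "?own (\<sigma> (2 * u)) = ?own (\<sigma> (p + 1))"
      by (auto simp: p_def doubleton_eq_iff)
    then show ?thesis
    proof cases
      case 1
      then show ?thesis using 2 by (intro main[of "2 * u"]) (auto simp: p_def partner_def)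
    next
      case 2
      then show ?thesis using \<open>u < L\<close> by (intro main[of "2 * u + 1"]) (auto simp: p_def partner_def)
    qed
  qed
qed

text \<open>Origin of the constants: all weights \<open>q\<close> together are at most
  \<open>4 * K + 16 * K ^ 2 \<le> 20 * K ^ 2\<close>, and \<open>card_avoiding_ge\<close> multiplies
  by 4, whence 80. The events through one given position or value weigh at most
  \<open>20 * K ^ 2 / N\<close>. An event has at most 4 positions and 4 values, so the threshold 1/4
  asks for 1/32 each, whence 640 = 20 * 32.\<close>

theorem card_proper_permutations_ge:
  fixes xs :: "'a list"
  assumes len: "length xs = 2 * L" and K: "\<And>y. count (mset xs) y \<le> K" "K \<ge> 1"
    and large: "640 * real K ^ 2 \<le> real (2 * L)"
  shows "exp (- 80 * real K ^ 2) * fact (2 * L)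
    \<le> real (card {\<sigma>. \<sigma> permutes {..<2 * L} \<and> proper (permute_list \<sigma> xs)})"
proof -
  define N where "N = 2 * L"
  define X where "X = {..<N}"
  define own where "own = (!) xs"
  define \<B> where "\<B> = loops N own \<union> doubles N own"
  define q where "q = (\<lambda>F :: (nat \<times> nat) set. (2 / real N) ^ card F)"
  have K2: "real K \<le> real K ^ 2" using K(2) self_le_power[of "real K" 2] by simp
  have "1 \<le> real K ^ 2" using K(2) by simp
  then have N640: "real N \<ge> 640" using large unfolding N_def by linarith
  \<comment> \<open>Events have at most 4 pairs, and \<open>permutation_extends_le\<close> asks for
    \<open>2 * 4 \<le> N + 2\<close>.\<close>
  then have N6: "N \<ge> 6" by linarith
  have fib: "card {v. v < N \<and> own v = y} \<le> K" for y
    using K(1)[of y] len unfolding count_mset count_list_eq_length_filter length_filter_conv_card own_def N_def by (simp add: eq_commute[of y])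
  note ev = finite_loops[OF N_def fib] card_loops[OF N_def fib] card_loops_fst[OF N_def fib]
    card_loops_snd[OF N_def fib] finite_doubles[OF N_def fib] card_doubles[OF N_def fib]
    card_doubles_fst[OF N_def fib] card_doubles_snd[OF N_def fib]
  have fin\<B>: "finite \<B>" by (simp add: \<B>_def ev)
  have loopD: "card F = 2 \<and> inj_on fst F \<and> inj_on snd F \<and> snd ` F \<subseteq> X" if "F \<in> loops N own" for F
    using that loop_event_simps by (fastforce simp: loops_def loop_event_def X_def)
  have doubleD: "card F = 4 \<and> inj_on fst F \<and> inj_on snd F \<and> snd ` F \<subseteq> X" if F: "F \<in> doubles N own" for F
  proof -
    obtain p q a b c d where F: "F = double_event p q a c b d" "p \<noteq> q" "p \<noteq> partner q" "distinct [a, b, c, d]"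
      and "a < N" "b < N" "c < N" "d < N"
      using F by (auto simp: doubles_def)
    then have "snd ` F \<subseteq> X" by (auto simp: double_event_def X_def)
    with double_event_simps[OF F(2-4)] F(1) show ?thesis by blast
  qed
  have BD: "finite F" "card F \<le> 4" "inj_on fst F" "inj_on snd F" "snd ` F \<subseteq> X" if "F \<in> \<B>" for F
    using loopD[of F] doubleD[of F] that card_ge_0_finite[of F] by (auto simp: \<B>_def)
  have sum_q: "(\<Sum>F | F \<in> \<B> \<and> P F. q F) \<le> real l * (2 / real N) ^ 2 + real d * (2 / real N) ^ 4"
    if "card {F \<in> loops N own. P F} \<le> l" "card {F \<in> doubles N own. P F} \<le> d" for P l d
  proof -
    have "{F. F \<in> \<B> \<and> P F} = {F \<in> loops N own. P F} \<union> {F \<in> doubles N own. P F}"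
      by (auto simp: \<B>_def)
    then have "(\<Sum>F | F \<in> \<B> \<and> P F. q F) \<le> (\<Sum>F\<in>{F \<in> loops N own. P F}. q F) + (\<Sum>F\<in>{F \<in> doubles N own. P F}. q F)"
      using ev by (simp add: sum_Un q_def sum_nonneg)
    also have "(\<Sum>F\<in>{F \<in> loops N own. P F}. q F) = real (card {F \<in> loops N own. P F}) * (2 / real N) ^ 2"
      using loopD by (simp add: q_def)
    also have "(\<Sum>F\<in>{F \<in> doubles N own. P F}. q F) = real (card {F \<in> doubles N own. P F}) * (2 / real N) ^ 4"
      using doubleD by (simp add: q_def)
    also have "real (card {F \<in> loops N own. P F}) * (2 / real N) ^ 2 + real (card {F \<in> doubles N own. P F}) * (2 / real N) ^ 4
      \<le> real l * (2 / real N) ^ 2 + real d * (2 / real N) ^ 4"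
      using that by (intro add_mono mult_right_mono) auto
    finally show ?thesis .
  qed
  have total: "(\<Sum>F\<in>\<B>. q F) \<le> 20 * real K ^ 2"
  proof -
    have "(\<Sum>F\<in>\<B>. q F) \<le> real (N * (N * K)) * (2 / real N) ^ 2 + real (N * (N * ((N * K) * (N * K)))) * (2 / real N) ^ 4"
      using sum_q[of "\<lambda>_. True" "N * (N * K)" "N * (N * ((N * K) * (N * K)))"] ev(2,6) by simp
    also have "\<dots> = 4 * real K + 16 * real K ^ 2"
      using N6 by (simp add: field_simps power2_eq_square power4_eq_xxxx)
    finally show ?thesis using K2 by linarith
  qed
  have single: "l * (2 / real N) ^ 2 + d * (2 / real N) ^ 4 \<le> 1 / 32"
    if "l = real (N * K)" "d = real (N * ((N * K) * (N * K)))" for l d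
  proof -
    have "l * (2 / real N) ^ 2 + d * (2 / real N) ^ 4 = (4 * real K + 16 * real K ^ 2) / real N"
      using N6 that by (simp add: field_simps power2_eq_square power4_eq_xxxx)
    also have "\<dots> \<le> (20 * real K ^ 2) / real N" using K2 by (intro divide_right_mono) auto
    also have "\<dots> \<le> 1 / 32" using large N6 by (simp add: N_def field_simps)
    finally show ?thesis .
  qed
  have q_nonneg: "0 \<le> q F" for F by (simp add: q_def)
  have conflict_sum: "(\<Sum>F | F \<in> \<B> \<and> conflict A F. q F) \<le> 1 / 4" if A: "A \<in> \<B>" for A
  proof -
    let ?P = "\<lambda>r. {F. F \<in> \<B> \<and> r \<in> fst ` F}" and ?V = "\<lambda>v. {F. F \<in> \<B> \<and> v \<in> snd ` F}"
    have P: "(\<Sum>F\<in>?P r. q F) \<le> 1 / 32" for r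
      using sum_q[OF ev(3) ev(7)] single[OF refl refl] by (rule order_trans)
    have V: "(\<Sum>F\<in>?V v. q F) \<le> 1 / 32" for v
      using sum_q[OF ev(4) ev(8)] single[OF refl refl] by (rule order_trans)
    have "{F. F \<in> \<B> \<and> conflict A F} \<subseteq> (\<Union>r\<in>fst ` A. ?P r) \<union> (\<Union>v\<in>snd ` A. ?V v)"
      by (auto simp: conflict_def)
    then have "(\<Sum>F | F \<in> \<B> \<and> conflict A F. q F) \<le> sum q ((\<Union>r\<in>fst ` A. ?P r) \<union> (\<Union>v\<in>snd ` A. ?V v))"
      using fin\<B> BD[OF A] q_nonneg by (intro sum_mono2) auto
    also have "\<dots> \<le> sum q (\<Union>r\<in>fst ` A. ?P r) + sum q (\<Union>v\<in>snd ` A. ?V v)"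
      using fin\<B> BD[OF A] q_nonneg by (simp add: sum_Un sum_nonneg)
    also have "sum q (\<Union>r\<in>fst ` A. ?P r) \<le> (\<Sum>r\<in>fst ` A. \<Sum>F\<in>?P r. q F)"
      using fin\<B> BD[OF A] q_nonneg by (intro sum_UNION_le) auto
    also have "\<dots> \<le> real (card (fst ` A)) * (1 / 32)" using P by (rule sum_bounded_above)
    also have "sum q (\<Union>v\<in>snd ` A. ?V v) \<le> (\<Sum>v\<in>snd ` A. \<Sum>F\<in>?V v. q F)"
      using fin\<B> BD[OF A] q_nonneg by (intro sum_UNION_le) auto
    also have "\<dots> \<le> real (card (snd ` A)) * (1 / 32)" using V by (rule sum_bounded_above)
    finally show ?thesis using BD[OF A] by (simp add: card_image)
  qed
  interpret lopsided "{\<sigma>. \<sigma> permutes X}" extends \<B> conflict q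
  proof
    show "finite {\<sigma>. \<sigma> permutes X}" by (simp add: X_def finite_permutations)
    show "finite \<B>" by (rule fin\<B>)
    show "0 \<le> q A" for A by (rule q_nonneg)
    show "q A \<le> 1 / 4" if A: "A \<in> \<B>" for A
    proof -
      \<comment> \<open>As \<open>A\<close> conflicts with itself, \<open>q A\<close> is one term of
        its own conflict sum.\<close>
      have "A \<noteq> {}" using A loopD[of A] doubleD[of A] by (auto simp: \<B>_def)
      then have "conflict A A" by (simp add: conflict_def)
      then have "q A \<le> (\<Sum>F | F \<in> \<B> \<and> conflict A F. q F)"
        using A fin\<B> q_nonneg by (intro member_le_sum) auto
      with conflict_sum[OF A] show ?thesis by simp
    qed
    show "(\<Sum>F | F \<in> \<B> \<and> conflict A F. q F) \<le> 1 / 4" if "A \<in> \<B>" for A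
      using that by (rule conflict_sum)
    show "real (card {\<sigma> \<in> avoiding {\<sigma>. \<sigma> permutes X} extends S. extends \<sigma> A})
        \<le> q A * real (card (avoiding {\<sigma>. \<sigma> permutes X} extends S))"
      if A: "A \<in> \<B>" "\<forall>F\<in>S. \<not> conflict A F" for A S
      using permutation_extends_le[of X A S] A BD[OF A(1)] N6 by (simp add: X_def q_def)
  qed
  have "card {\<sigma>. \<sigma> permutes X} = fact N" by (rule card_permutations) (simp_all add: X_def)
  then have "exp (- 80 * real K ^ 2) * fact N \<le> exp (- 4 * (\<Sum>A\<in>\<B>. q A)) * real (card {\<sigma>. \<sigma> permutes X})"
    using total by simp
  also have "\<dots> \<le> real (card (avoiding {\<sigma>. \<sigma> permutes X} extends \<B>))" by (rule card_avoiding_ge)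
  also have "\<dots> \<le> real (card {\<sigma>. \<sigma> permutes X \<and> proper (permute_list \<sigma> xs)})"
    using improper_permute_extends[OF len]
    by (intro of_nat_mono card_mono) (auto simp: avoiding_def X_def N_def \<B>_def own_def finite_permutations)
  finally show ?thesis by (simp add: X_def N_def)
qed

text \<open>Both bounds compare the proper words with all words over \<open>M\<close>. The lower
  bound passes through permutations, where the common fibre size \<open>s\<close> cancels.\<close>

theorem card_realizations_bounds:
  fixes M :: "'a multiset"
  assumes size: "size M = 2 * L"
  shows "real (card (realizations M)) * (2 ^ L * fact L * (\<Prod>x\<in>set_mset M. fact (count M x))) \<le> fact (2 * L)"
    and "\<lbrakk>\<And>y. count M y \<le> K; K \<ge> 1; 640 * real K ^ 2 \<le> real (2 * L)\<rbrakk> \<Longrightarrow>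
      exp (- 80 * real K ^ 2) * fact (2 * L)
        \<le> real (card (realizations M)) * (2 ^ L * fact L * (\<Prod>x\<in>set_mset M. fact (count M x)))"
proof -
  let ?W = "card (permutations_of_multiset M)" and ?G = "card {ws \<in> permutations_of_multiset M. proper ws}"
    and ?f = "\<Prod>x\<in>set_mset M. fact (count M x) :: nat"
  have Wf: "?W * ?f = fact (2 * L)" using card_permutations_of_multiset_aux[of M] size by simp
  have G: "?G * ?f = card (realizations M) * (2 ^ L * fact L * ?f)"
    by (simp add: card_proper_words[OF size])
  have realG: "real (card (realizations M)) * (2 ^ L * fact L * (\<Prod>x\<in>set_mset M. fact (count M x))) = real (?G * ?f)"
    unfolding G by simp
  have "?G * ?f \<le> ?W * ?f"
    by (intro mult_le_mono1 card_mono) auto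
  then have "real (?G * ?f) \<le> real (fact (2 * L))" unfolding Wf by (rule of_nat_mono)
  then show "real (card (realizations M)) * (2 ^ L * fact L * (\<Prod>x\<in>set_mset M. fact (count M x))) \<le> fact (2 * L)"
    unfolding realG by simp
  assume K: "\<And>y. count M y \<le> K" "K \<ge> 1" "640 * real K ^ 2 \<le> real (2 * L)"
  obtain xs where xs: "mset xs = M" using ex_mset by blast
  then have len: "length xs = 2 * L" using size by (metis size_mset)
  let ?P = "{\<sigma>. \<sigma> permutes {..<2 * L}}"
  define s where "s = card {\<sigma> \<in> ?P. permute_list \<sigma> xs = xs}"
  note cp = card_permutations_words[of xs, unfolded len xs, folded s_def]
  have "fact (2 * L) = s * ?W" using cp[of "\<lambda>_. True"] by (simp add: card_permutations)
  moreover have "exp (- 80 * real K ^ 2) * fact (2 * L) \<le> real (s * ?G)"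
    using card_proper_permutations_ge[OF len _ K(2,3)] K(1) cp[of proper] by (simp add: xs)
  moreover have "(fact (2 * L) :: real) = real (fact (2 * L))" by simp
  ultimately have "exp (- 80 * real K ^ 2) * real (s * ?W) \<le> real (s * ?G)" by metis
  moreover have "s > 0" using \<open>fact (2 * L) = s * ?W\<close> by (metis fact_gt_zero zero_less_mult_iff mult_is_0 gr0I less_irrefl)
  ultimately have "exp (- 80 * real K ^ 2) * real ?W \<le> real ?G"
    by (simp add: mult.left_commute)
  then have "exp (- 80 * real K ^ 2) * real ?W * real ?f \<le> real ?G * real ?f"
    by (rule mult_right_mono) (rule of_nat_0_le_iff)
  then have "exp (- 80 * real K ^ 2) * real (?W * ?f) \<le> real (?G * ?f)" by (simp add: mult.assoc)
  then show "exp (- 80 * real K ^ 2) * fact (2 * L)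
        \<le> real (card (realizations M)) * (2 ^ L * fact L * (\<Prod>x\<in>set_mset M. fact (count M x)))"
    unfolding Wf realG by simp
qed

section \<open>Entropy maximisers\<close>

text \<open>Convexity of \<open>x * ln x\<close>: the tangent at \<open>m\<close> lies below the
  graph. Summed over points, this is Gibbs' inequality.\<close>

lemma x_ln_x_tangent:
  fixes a m :: real
  assumes "0 \<le> a" "0 < m"
  shows "a * ln m + a - m \<le> a * ln a"
proof (cases "a = 0")
  case False
  then have "a > 0" using assms by simp
  have "ln (m / a) \<le> m / a - 1" using \<open>a > 0\<close> assms by (intro ln_le_minus_one) simp
  then have "a * ln (m / a) \<le> a * (m / a - 1)" using \<open>a > 0\<close> by (intro mult_left_mono) auto
  then show ?thesis using \<open>a > 0\<close> assms by (simp add: ln_div algebra_simps)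
qed (use assms in simp)

lemma continuous_on_x_ln_x: "continuous_on {0..} (\<lambda>x :: real. x * ln x)"
proof -
  have "((\<lambda>x :: real. x * ln x) \<longlongrightarrow> 0) (at_right 0)" by real_asymp
  moreover have "at 0 within {0 :: real..} = at_right 0"
    by (metis at_within_Icc_at_right at_within_Ici_at_right)
  ultimately have "continuous (at 0 within {0..}) (\<lambda>x :: real. x * ln x)"
    by (simp add: continuous_within)
  moreover have "continuous (at x within {0..}) (\<lambda>x :: real. x * ln x)" if "x > 0" for x
    using that by (intro continuous_intros) auto
  ultimately show ?thesis
    unfolding continuous_on_eq_continuous_within by (metis atLeast_iff less_eq_real_def)
qed

lemma ex_pmf_of_weights:
  fixes w :: "'g \<Rightarrow> real"
  assumes "finite \<G>" "\<And>x. 0 \<le> w x" "\<And>x. x \<notin> \<G> \<Longrightarrow> w x = 0" "sum w \<G> = 1"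
  shows "\<exists>P. pmf P = w \<and> set_pmf P \<subseteq> \<G>"
proof -
  have "(\<integral>\<^sup>+x. ennreal (w x) \<partial>count_space UNIV) = (\<Sum>x\<in>\<G>. ennreal (w x))"
    using assms by (intro nn_integral_count_space') auto
  also have "\<dots> = 1" using assms by (simp add: sum_ennreal)
  finally have "pmf (embed_pmf w) x = w x" for x
    using assms by (intro pmf_embed_pmf) auto
  then have "pmf (embed_pmf w) = w" by blast
  then show ?thesis using assms(3) by (metis set_pmf_iff subsetI)
qed

lemma compact_PiE_UNIV:
  fixes S :: "'i \<Rightarrow> 'a :: topological_space set"
  assumes "\<And>i. compact (S i)"
  shows "compact (Pi UNIV S)"
proof -
  have "compactin (product_topology (\<lambda>i. euclidean) UNIV) (Pi\<^sub>E UNIV S)"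
    using assms by (simp add: compactin_PiE)
  then show ?thesis by (simp add: euclidean_product_topology PiE_UNIV_domain)
qed

text \<open>Mass functions are viewed in the full function space with the product topology and
  forced to be 0 off \<open>\<G>\<close>, so that Tychonoff's theorem gives compactness.\<close>

lemma ex_entropy_maximiser:
  assumes fin: "finite \<G>" and P0: "soft_constraint \<G> I C c P0"
  shows "\<exists>Q. is_arg_max (shannon_entropy \<G>) (soft_constraint \<G> I C c) Q"
proof -
  define B where "B = Pi UNIV (\<lambda>x. if x \<in> \<G> then {0..1 :: real} else {0})"
  define T where "T = {p. sum p \<G> = (1 :: real)} \<inter> (\<Inter>i\<in>I. {p. (\<Sum>x\<in>\<G>. p x * C x i) = c i})"
  have "compact B" unfolding B_def by (intro compact_PiE_UNIV) auto
  moreover have "closed T"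
    unfolding T_def
    by (intro closed_Int closed_INT ballI closed_Collect_eq continuous_intros continuous_on_product_coordinates)
  ultimately have comp: "compact (B \<inter> T)" by (rule compact_Int_closed)
  have pmf_BT: "pmf P \<in> B \<inter> T" if "soft_constraint \<G> I C c P" for P
    using that fin sum_pmf_eq_1[of \<G> P]
    by (auto simp: B_def T_def soft_constraint_def pmf_le_1 set_pmf_iff)
  then have ne: "B \<inter> T \<noteq> {}" using P0 by blast
  have cont: "continuous_on (B \<inter> T) (\<lambda>p. - (\<Sum>x\<in>\<G>. p x * ln (p x)))"
  proof (intro continuous_on_minus continuous_on_sum)
    fix x assume "x \<in> \<G>"
    then have sub: "(\<lambda>p. p x) ` (B \<inter> T) \<subseteq> {0..}" by (auto simp: B_def Pi_iff) (metis atLeastAtMost_iff)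
    have "continuous_on (B \<inter> T) (\<lambda>p. p x)"
      by (rule continuous_on_subset[OF continuous_on_product_coordinates]) simp
    from continuous_on_compose2[OF continuous_on_x_ln_x this sub]
    show "continuous_on (B \<inter> T) (\<lambda>p. p x * ln (p x))" by simp
  qed
  from continuous_attains_sup[OF comp ne cont] obtain p where p: "p \<in> B \<inter> T"
    and max: "\<And>r. r \<in> B \<inter> T \<Longrightarrow> - (\<Sum>x\<in>\<G>. r x * ln (r x)) \<le> - (\<Sum>x\<in>\<G>. p x * ln (p x))"
    by blast
  have "p x \<in> (if x \<in> \<G> then {0..1} else {0})" for x using p unfolding B_def by blast
  then have pos: "0 \<le> p x" and off: "x \<notin> \<G> \<Longrightarrow> p x = 0" for x
    by (smt (verit) atLeastAtMost_iff singletonD)+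
  obtain Q where Q: "pmf Q = p" "set_pmf Q \<subseteq> \<G>"
    using ex_pmf_of_weights[of \<G> p] fin pos off p by (auto simp: T_def)
  have "soft_constraint \<G> I C c Q" using Q p by (simp add: soft_constraint_def T_def)
  moreover have "shannon_entropy \<G> P \<le> shannon_entropy \<G> Q" if "soft_constraint \<G> I C c P" for P
    using max[OF pmf_BT[OF that]] Q by (simp add: shannon_entropy_def)
  ultimately show ?thesis by (auto simp: is_arg_max_linorder)
qed

lemma is_arg_max_canonical:
  assumes "finite \<G>" "soft_constraint \<G> I C c P"
  shows "is_arg_max (shannon_entropy \<G>) (soft_constraint \<G> I C c) (canonical \<G> I C c)"
  unfolding canonical_def arg_max_def using ex_entropy_maximiser[OF assms] by (rule someI_ex)

context
  fixes \<G> :: "'g set" and I :: "'i set" and C c Q P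
  assumes fin: "finite \<G>" and Q: "is_arg_max (shannon_entropy \<G>) (soft_constraint \<G> I C c) Q"
    and P: "soft_constraint \<G> I C c P"
begin

text \<open>With \<open>r\<close> for the perturbed weights, maximality bounds the sum of
  \<open>Q ln Q\<close> by that of \<open>r ln r\<close>, and Gibbs' inequality bounds the sum of
  \<open>Q ln r\<close> by that of \<open>Q ln Q\<close>. Hence the sum of
  \<open>(r - Q) ln r\<close> is nonnegative. This replaces differentiating the entropy, makes sense
  where \<open>Q\<close> vanishes, and allows either sign of \<epsilon>.\<close>

lemma entropy_perturbation:
  assumes R: "\<And>x. 0 \<le> pmf Q x + \<epsilon> * (pmf P x - pmf Q x)"
    and supp: "\<And>x. x \<in> \<G> \<Longrightarrow> pmf Q x + \<epsilon> * (pmf P x - pmf Q x) = 0 \<Longrightarrow> pmf Q x = 0"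
  shows "0 \<le> \<epsilon> * (\<Sum>x\<in>\<G>. (pmf P x - pmf Q x) * ln (pmf Q x + \<epsilon> * (pmf P x - pmf Q x)))"
proof -
  define r where "r = (\<lambda>x. pmf Q x + \<epsilon> * (pmf P x - pmf Q x))"
  have sQ: "soft_constraint \<G> I C c Q" using Q by (simp add: is_arg_max_def)
  have sums: "sum (pmf P) \<G> = 1" "sum (pmf Q) \<G> = 1"
    using P sQ fin by (auto simp: soft_constraint_def intro: sum_pmf_eq_1)
  have sum_r: "sum r \<G> = 1"
    using sums by (simp add: r_def sum.distrib sum_subtractf flip: sum_distrib_left)
  have "\<exists>R. pmf R = r \<and> set_pmf R \<subseteq> \<G>"
  proof (rule ex_pmf_of_weights[OF fin])
    show "0 \<le> r x" for x using R by (simp add: r_def)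
    show "r x = 0" if "x \<notin> \<G>" for x
    proof -
      have "x \<notin> set_pmf P" "x \<notin> set_pmf Q" using that P sQ by (auto simp: soft_constraint_def)
      then show ?thesis by (simp add: r_def set_pmf_iff)
    qed
  qed (rule sum_r)
  then obtain R where R': "pmf R = r" "set_pmf R \<subseteq> \<G>" by blast
  have "soft_constraint \<G> I C c R"
    unfolding soft_constraint_def
  proof (intro conjI ballI)
    fix i assume "i \<in> I"
    have "(\<Sum>x\<in>\<G>. pmf R x * C x i) = (\<Sum>x\<in>\<G>. pmf Q x * C x i)
      + \<epsilon> * ((\<Sum>x\<in>\<G>. pmf P x * C x i) - (\<Sum>x\<in>\<G>. pmf Q x * C x i))"
      unfolding sum_subtractf[symmetric] sum_distrib_left sum.distrib[symmetric]
      by (intro sum.cong) (auto simp: R' r_def algebra_simps)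
    then show "(\<Sum>x\<in>\<G>. pmf R x * C x i) = c i"
      using P sQ \<open>i \<in> I\<close> by (simp add: soft_constraint_def)
  qed (rule R')
  then have "shannon_entropy \<G> R \<le> shannon_entropy \<G> Q"
    using Q by (auto simp: is_arg_max_linorder)
  then have 1: "(\<Sum>x\<in>\<G>. pmf Q x * ln (pmf Q x)) \<le> (\<Sum>x\<in>\<G>. r x * ln (r x))"
    by (simp add: shannon_entropy_def R')
  have "(\<Sum>x\<in>\<G>. pmf Q x * ln (r x) + pmf Q x - r x) \<le> (\<Sum>x\<in>\<G>. pmf Q x * ln (pmf Q x))"
  proof (rule sum_mono)
    fix x assume x: "x \<in> \<G>"
    show "pmf Q x * ln (r x) + pmf Q x - r x \<le> pmf Q x * ln (pmf Q x)"
    proof (cases "r x = 0")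
      case True
      then have "pmf Q x = 0" using supp[OF x] by (simp add: r_def)
      then show ?thesis by (simp add: True)
    next
      case False
      moreover have "0 \<le> r x" using R by (simp add: r_def)
      ultimately show ?thesis by (intro x_ln_x_tangent) auto
    qed
  qed
  then have "(\<Sum>x\<in>\<G>. pmf Q x * ln (r x)) \<le> (\<Sum>x\<in>\<G>. pmf Q x * ln (pmf Q x))"
    using sums sum_r by (simp add: sum.distrib sum_subtractf)
  with 1 have "0 \<le> (\<Sum>x\<in>\<G>. r x * ln (r x)) - (\<Sum>x\<in>\<G>. pmf Q x * ln (r x))" by linarith
  also have "\<dots> = \<epsilon> * (\<Sum>x\<in>\<G>. (pmf P x - pmf Q x) * ln (r x))"
    unfolding sum_subtractf[symmetric] sum_distrib_left
    by (intro sum.cong) (auto simp: r_def algebra_simps)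
  finally show ?thesis by (simp add: r_def)
qed

text \<open>The slope of \<open>- x * ln x\<close> at 0 is infinite. If \<open>Q\<close> missed
  \<open>x0\<close>, then on moving by \<epsilon> towards \<open>P\<close> the term
  \<open>pmf P x0 * ln (\<epsilon> * pmf P x0)\<close> would tend to minus infinity, while
  optimality bounds it from below.\<close>

lemma maximiser_support:
  assumes x0: "x0 \<in> \<G>" "pmf P x0 > 0"
  shows "pmf Q x0 > 0"
proof (rule ccontr)
  assume "\<not> pmf Q x0 > 0"
  then have Q0: "pmf Q x0 = 0" by (simp add: order_less_le)
  have sQ: "soft_constraint \<G> I C c Q" using Q by (simp add: is_arg_max_def)
  have sumQ: "sum (pmf Q) \<G> = 1"
    using sQ fin by (auto simp: soft_constraint_def intro: sum_pmf_eq_1)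
  define h where "h = (\<Sum>x\<in>\<G>. pmf Q x * ln (pmf Q x))"
  have bound: "h - ln 2 \<le> pmf P x0 * ln (\<epsilon> * pmf P x0)" if \<epsilon>: "0 < \<epsilon>" "\<epsilon> \<le> 1 / 2" for \<epsilon>
  proof -
    define r where "r = (\<lambda>x. pmf Q x + \<epsilon> * (pmf P x - pmf Q x))"
    have r: "r x = (1 - \<epsilon>) * pmf Q x + \<epsilon> * pmf P x" for x by (simp add: r_def algebra_simps)
    have r0: "0 \<le> r x" for x using \<epsilon> by (simp add: r)
    have r1: "r x \<le> 1" for x
      using \<epsilon> convex_bound_le[OF pmf_le_1[of Q x] pmf_le_1[of P x], of "1 - \<epsilon>" \<epsilon>] by (simp add: r)
    \<comment> \<open>At least half of \<open>Q\<close> survives as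
      \<open>\<epsilon> \<le> 1 / 2\<close>; this is the source of \<open>ln 2\<close>.\<close>
    have rQ: "r x \<ge> pmf Q x / 2" for x
    proof -
      have "1 / 2 * pmf Q x \<le> (1 - \<epsilon>) * pmf Q x" using \<epsilon> by (intro mult_right_mono) auto
      moreover have "0 \<le> \<epsilon> * pmf P x" using \<epsilon> by simp
      ultimately show ?thesis by (simp add: r)
    qed
    have "0 \<le> \<epsilon> * (\<Sum>x\<in>\<G>. (pmf P x - pmf Q x) * ln (r x))"
      unfolding r_def
    proof (rule entropy_perturbation)
      show "0 \<le> pmf Q x + \<epsilon> * (pmf P x - pmf Q x)" for x using r0 by (simp add: r_def)
      show "pmf Q x = 0" if "pmf Q x + \<epsilon> * (pmf P x - pmf Q x) = 0" for x
        using rQ[of x] that pmf_nonneg[of Q x] by (simp add: r_def)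
    qed
    then have "0 \<le> (\<Sum>x\<in>\<G>. (pmf P x - pmf Q x) * ln (r x))"
      using \<epsilon> by (simp add: zero_le_mult_iff)
    then have "(\<Sum>x\<in>\<G>. pmf Q x * ln (r x)) \<le> (\<Sum>x\<in>\<G>. pmf P x * ln (r x))"
      by (simp add: left_diff_distrib sum_subtractf)
    also have "\<dots> \<le> (\<Sum>x\<in>{x0}. pmf P x * ln (r x))"
    proof -
      have "pmf P x * ln (r x) \<le> 0" for x
        using r0[of x] r1[of x] by (cases "r x = 0") (auto intro: mult_nonneg_nonpos)
      then have "(\<Sum>x\<in>{x0}. - (pmf P x * ln (r x))) \<le> (\<Sum>x\<in>\<G>. - (pmf P x * ln (r x)))"
        using x0 fin by (intro sum_mono2) auto
      then show ?thesis by (simp add: sum_negf)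
    qed
    also have "\<dots> = pmf P x0 * ln (\<epsilon> * pmf P x0)" by (simp add: r Q0)
    finally have 1: "(\<Sum>x\<in>\<G>. pmf Q x * ln (r x)) \<le> pmf P x0 * ln (\<epsilon> * pmf P x0)" .
    have "h - ln 2 = (\<Sum>x\<in>\<G>. pmf Q x * ln (pmf Q x) - pmf Q x * ln 2)"
      using sumQ by (simp add: h_def sum_subtractf flip: sum_distrib_right)
    also have "\<dots> \<le> (\<Sum>x\<in>\<G>. pmf Q x * ln (r x))"
    proof (rule sum_mono)
      fix x
      show "pmf Q x * ln (pmf Q x) - pmf Q x * ln 2 \<le> pmf Q x * ln (r x)"
      proof (cases "pmf Q x = 0")
        case False
        then have "pmf Q x > 0" by (simp add: order_less_le)
        then have "ln (pmf Q x / 2) \<le> ln (r x)" using rQ[of x] by simp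
        then have "ln (pmf Q x) - ln 2 \<le> ln (r x)" using \<open>pmf Q x > 0\<close> by (simp add: ln_div)
        from mult_left_mono[OF this, of "pmf Q x"] show ?thesis by (simp add: algebra_simps)
      qed simp
    qed
    finally show ?thesis using 1 by linarith
  qed
  have "filterlim (\<lambda>\<epsilon>. pmf P x0 * ln (\<epsilon> * pmf P x0)) at_bot (at_right 0)"
    using x0 by real_asymp
  then have "eventually (\<lambda>\<epsilon>. pmf P x0 * ln (\<epsilon> * pmf P x0) < h - ln 2) (at_right 0)"
    by (simp add: filterlim_at_bot_dense)
  moreover have "eventually (\<lambda>\<epsilon> :: real. \<epsilon> \<in> {0<..<1 / 2}) (at_right 0)"
    by (rule eventually_at_right_real) simp
  ultimately have "eventually (\<lambda>\<epsilon> :: real. False) (at_right 0)"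
    by eventually_elim (use bound in fastforce)
  then show False by simp
qed

text \<open>Since \<open>P\<close> vanishes wherever \<open>Q\<close> does, \<open>Q\<close> can be
  moved towards \<open>P\<close> and also slightly away from it. The perturbation inequality for
  both signs of \<epsilon> forces equality in the limit. For a Gibbs measure this would be
  immediate, \<open>ln Q\<close> being affine in the constrained quantities.\<close>

lemma maximiser_cross_entropy: "(\<Sum>x\<in>\<G>. pmf P x * ln (pmf Q x)) = - shannon_entropy \<G> Q"
proof -
  define A where "A = {x \<in> \<G>. pmf Q x > 0}"
  have finA: "finite A" using fin by (simp add: A_def)
  have off: "pmf Q x = 0" "pmf P x = 0" if "x \<in> \<G> - A" for x
  proof -
    show "pmf Q x = 0" using that by (auto simp: A_def order_less_le)
    with that show "pmf P x = 0" using maximiser_support[of x] by (auto simp: order_less_le)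
  qed
  define h where "h = (\<lambda>\<epsilon>. \<Sum>x\<in>A. (pmf P x - pmf Q x) * ln (pmf Q x + \<epsilon> * (pmf P x - pmf Q x)))"
  have "(h \<longlongrightarrow> h 0) (at 0)"
    unfolding h_def by (intro tendsto_intros tendsto_eq_intros | auto simp: A_def)+
  then have lim: "(h \<longlongrightarrow> h 0) (at_right 0)" "(h \<longlongrightarrow> h 0) (at_left 0)"
    by (auto simp: filterlim_at_split)
  obtain \<delta> where \<delta>: "\<delta> > 0" "\<And>x. x \<in> A \<Longrightarrow> \<delta> \<le> pmf Q x"
  proof
    \<comment> \<open>The inserted 1 keeps \<open>Min\<close> meaningful without first showing that
      \<open>A\<close> is nonempty.\<close>
    show "Min (insert 1 (pmf Q ` A)) > 0" using finA by (auto simp: A_def)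
    show "Min (insert 1 (pmf Q ` A)) \<le> pmf Q x" if "x \<in> A" for x using finA that by auto
  qed
  have sQ: "soft_constraint \<G> I C c Q" using Q by (simp add: is_arg_max_def)
  have key: "0 \<le> \<epsilon> * h \<epsilon>" if \<epsilon>: "\<bar>\<epsilon>\<bar> < \<delta>" for \<epsilon>
  proof -
    have pos: "0 < pmf Q x + \<epsilon> * (pmf P x - pmf Q x)" if "x \<in> A" for x
    proof -
      have "\<bar>pmf P x - pmf Q x\<bar> \<le> 1"
        using pmf_nonneg[of P x] pmf_le_1[of P x] pmf_nonneg[of Q x] pmf_le_1[of Q x] by linarith
      then have "\<bar>\<epsilon> * (pmf P x - pmf Q x)\<bar> \<le> \<bar>\<epsilon>\<bar> * 1"
        unfolding abs_mult by (intro mult_left_mono) auto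
      then show ?thesis using \<delta>(2)[OF that] \<epsilon> by linarith
    qed
    have zero: "pmf Q x = 0 \<and> pmf P x = 0" if "x \<notin> A" for x
      using that off[of x] P sQ by (cases "x \<in> \<G>") (auto simp: soft_constraint_def set_pmf_iff)
    have "0 \<le> \<epsilon> * (\<Sum>x\<in>\<G>. (pmf P x - pmf Q x) * ln (pmf Q x + \<epsilon> * (pmf P x - pmf Q x)))"
    proof (rule entropy_perturbation)
      show "0 \<le> pmf Q x + \<epsilon> * (pmf P x - pmf Q x)" for x
        using pos[of x] zero[of x] by (cases "x \<in> A") auto
      show "pmf Q x = 0" if "pmf Q x + \<epsilon> * (pmf P x - pmf Q x) = 0" for x
        using pos[of x] zero[of x] that by (cases "x \<in> A") auto
    qed
    also have "(\<Sum>x\<in>\<G>. (pmf P x - pmf Q x) * ln (pmf Q x + \<epsilon> * (pmf P x - pmf Q x))) = h \<epsilon>"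
      unfolding h_def using fin zero by (intro sum.mono_neutral_right) (auto simp: A_def)
    finally show ?thesis .
  qed
  have "h 0 \<ge> 0"
  proof (rule tendsto_lowerbound[OF lim(1)])
    have "0 \<le> h \<epsilon>" if "\<epsilon> \<in> {0<..<\<delta>}" for \<epsilon>
      using key[of \<epsilon>] that by (simp add: zero_le_mult_iff)
    then show "eventually (\<lambda>\<epsilon>. 0 \<le> h \<epsilon>) (at_right 0)"
      using eventually_at_right_real[OF \<delta>(1)] by (rule eventually_mono[rotated])
  qed simp
  moreover have "h 0 \<le> 0"
  proof (rule tendsto_upperbound[OF lim(2)])
    have neg: "h \<epsilon> \<le> 0" if "\<epsilon> \<in> {- \<delta><..<0}" for \<epsilon>
      using key[of \<epsilon>] that by (simp add: zero_le_mult_iff)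
    have "eventually (\<lambda>\<epsilon>. \<epsilon> \<in> {- \<delta><..<0}) (at_left 0)"
      using eventually_at_left_real[of "- \<delta>" 0] \<delta>(1) by simp
    then show "eventually (\<lambda>\<epsilon>. h \<epsilon> \<le> 0) (at_left 0)" by (rule eventually_mono) (rule neg)
  qed simp
  ultimately have "h 0 = 0" by simp
  moreover have "h 0 = (\<Sum>x\<in>\<G>. (pmf P x - pmf Q x) * ln (pmf Q x))"
    unfolding h_def using fin off by (intro sum.mono_neutral_cong_left) (auto simp: A_def)
  ultimately show ?thesis
    by (simp add: left_diff_distrib sum_subtractf shannon_entropy_def)
qed

end

lemma shannon_entropy_le_cross_entropy:
  assumes "finite \<G>" "set_pmf Q \<subseteq> \<G>" "sum w \<G> \<le> 1" "\<And>x. 0 \<le> w x"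
    and "\<And>x. x \<in> set_pmf Q \<Longrightarrow> 0 < w x"
  shows "shannon_entropy \<G> Q \<le> - (\<Sum>x\<in>\<G>. pmf Q x * ln (w x))"
proof -
  have "(\<Sum>x\<in>\<G>. pmf Q x * ln (w x) + pmf Q x - w x) \<le> (\<Sum>x\<in>\<G>. pmf Q x * ln (pmf Q x))"
  proof (rule sum_mono)
    fix x
    show "pmf Q x * ln (w x) + pmf Q x - w x \<le> pmf Q x * ln (pmf Q x)"
      using assms(4)[of x] assms(5)[of x] by (cases "x \<in> set_pmf Q") (auto simp: set_pmf_iff intro!: x_ln_x_tangent)
  qed
  then show ?thesis
    using assms sum_pmf_eq_1[of \<G> Q] by (simp add: sum.distrib sum_subtractf shannon_entropy_def)
qed

text \<open>The logarithm of the quotient splits because \<open>Q\<close> charges every point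
  charged by the microcanonical ensemble. The part with \<open>ln P\<close> is minus the logarithm
  of the number of admissible points; the cross term is given by
  \<open>maximiser_cross_entropy\<close>.\<close>

theorem relative_entropy_microcanonical_canonical:
  fixes C :: "'g \<Rightarrow> 'i \<Rightarrow> real"
  assumes fin: "finite \<G>" and x0: "x0 \<in> \<G>" "\<And>i. i \<in> I \<Longrightarrow> C x0 i = c i"
  defines "Q \<equiv> canonical \<G> I C c"
  shows "is_arg_max (shannon_entropy \<G>) (soft_constraint \<G> I C c) Q"
    and "relative_entropy \<G> (microcanonical \<G> I C c) Q
      = shannon_entropy \<G> Q - ln (real (card {x \<in> \<G>. \<forall>i\<in>I. C x i = c i}))"
proof -
  define \<Gamma> where "\<Gamma> = {x \<in> \<G>. \<forall>i\<in>I. C x i = c i}"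
  define P where "P = microcanonical \<G> I C c"
  have \<Gamma>: "\<Gamma> \<noteq> {}" "finite \<Gamma>" using fin x0 by (auto simp: \<Gamma>_def)
  have pmfP: "pmf P x = indicator \<Gamma> x / real (card \<Gamma>)" for x
    unfolding P_def microcanonical_def \<Gamma>_def[symmetric] by (rule pmf_of_set[OF \<Gamma>])
  have P: "soft_constraint \<G> I C c P"
    unfolding soft_constraint_def
  proof (intro conjI ballI)
    show "set_pmf P \<subseteq> \<G>"
      unfolding P_def microcanonical_def \<Gamma>_def[symmetric] set_pmf_of_set[OF \<Gamma>] by (simp add: \<Gamma>_def)
    fix i assume i: "i \<in> I"
    have "(\<Sum>x\<in>\<G>. pmf P x * C x i) = (\<Sum>x\<in>\<Gamma>. c i / real (card \<Gamma>))"
      using fin i by (intro sum.mono_neutral_cong_right) (auto simp: pmfP \<Gamma>_def indicator_def)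
    also have "\<dots> = c i" using \<Gamma> by simp
    finally show "(\<Sum>x\<in>\<G>. pmf P x * C x i) = c i" .
  qed
  show Q: "is_arg_max (shannon_entropy \<G>) (soft_constraint \<G> I C c) Q"
    unfolding Q_def by (rule is_arg_max_canonical[OF fin P])
  have "relative_entropy \<G> P Q = (\<Sum>x\<in>\<G>. pmf P x * ln (pmf P x) - pmf P x * ln (pmf Q x))"
    unfolding relative_entropy_def
  proof (rule sum.cong[OF refl])
    fix x assume x: "x \<in> \<G>"
    show "pmf P x * ln (pmf P x / pmf Q x) = pmf P x * ln (pmf P x) - pmf P x * ln (pmf Q x)"
    proof (cases "pmf P x = 0")
      case False
      then have "pmf P x > 0" by (simp add: order_less_le)
      with maximiser_support[OF fin Q P x] show ?thesis by (simp add: ln_div algebra_simps)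
    qed simp
  qed
  also have "\<dots> = (\<Sum>x\<in>\<G>. pmf P x * ln (pmf P x)) + shannon_entropy \<G> Q"
    using maximiser_cross_entropy[OF fin Q P] by (simp add: sum_subtractf)
  also have "(\<Sum>x\<in>\<G>. pmf P x * ln (pmf P x)) = (\<Sum>x\<in>\<Gamma>. 1 / real (card \<Gamma>) * ln (1 / real (card \<Gamma>)))"
    using fin by (intro sum.mono_neutral_cong_right) (auto simp: pmfP \<Gamma>_def)
  also have "\<dots> = - ln (real (card \<Gamma>))"
    using \<Gamma> by (simp add: ln_div card_gt_0_iff)
  finally show "relative_entropy \<G> (microcanonical \<G> I C c) Q
      = shannon_entropy \<G> Q - ln (real (card {x \<in> \<G>. \<forall>i\<in>I. C x i = c i}))"
    by (simp add: P_def \<Gamma>_def)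
qed

section \<open>Entropy of the canonical ensemble\<close>

lemma sum_product_weights:
  fixes p :: "'e \<Rightarrow> real"
  assumes fin: "finite E"
  defines "b \<equiv> \<lambda>G. (\<Prod>e\<in>G. p e) * (\<Prod>e\<in>E - G. 1 - p e)"
  shows "(\<Sum>G\<in>Pow E. b G) = 1"
    and "(\<Sum>G\<in>Pow E. b G * (\<Sum>e\<in>G. F e)) = (\<Sum>e\<in>E. p e * F e)"
proof -
  show "(\<Sum>G\<in>Pow E. b G) = 1"
    using prod_add[OF fin, of p "\<lambda>e. 1 - p e"] by (simp add: b_def)
  have marginal: "(\<Sum>G\<in>Pow E. if e \<in> G then b G else 0) = p e" if e: "e \<in> E" for e
  proof -
    \<comment> \<open>Replacing the factor \<open>1 - p e\<close> by 0 kills the sets that miss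
      \<open>e\<close> and leaves the others untouched, so the marginal is again an expanded
      product.\<close>
    let ?f = "\<lambda>x. if x = e then 0 else 1 - p x"
    have "(\<Sum>G\<in>Pow E. if e \<in> G then b G else 0) = (\<Sum>G\<in>Pow E. (\<Prod>x\<in>G. p x) * (\<Prod>x\<in>E - G. ?f x))"
    proof (rule sum.cong[OF refl])
      fix G assume "G \<in> Pow E"
      have "(\<Prod>x\<in>E - G. ?f x) = (if e \<in> G then (\<Prod>x\<in>E - G. 1 - p x) else 0)"
        using e fin by (auto intro!: prod.cong prod_zero)
      then show "(if e \<in> G then b G else 0) = (\<Prod>x\<in>G. p x) * (\<Prod>x\<in>E - G. ?f x)"
        by (simp add: b_def)
    qed
    also have "\<dots> = (\<Prod>x\<in>E. p x + ?f x)" by (rule prod_add[OF fin, symmetric])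
    also have "\<dots> = (\<Prod>x\<in>E. if x = e then p e else 1)" by (intro prod.cong) auto
    also have "\<dots> = p e" using e fin by simp
    finally show ?thesis .
  qed
  have "(\<Sum>G\<in>Pow E. b G * (\<Sum>e\<in>G. F e)) = (\<Sum>G\<in>Pow E. \<Sum>e\<in>E. (if e \<in> G then b G else 0) * F e)"
  proof (rule sum.cong[OF refl])
    fix G assume "G \<in> Pow E"
    then show "b G * (\<Sum>e\<in>G. F e) = (\<Sum>e\<in>E. (if e \<in> G then b G else 0) * F e)"
      unfolding sum_distrib_left using fin by (intro sum.mono_neutral_cong_left) auto
  qed
  also have "\<dots> = (\<Sum>e\<in>E. \<Sum>G\<in>Pow E. (if e \<in> G then b G else 0) * F e)" by (rule sum.swap)
  also have "\<dots> = (\<Sum>e\<in>E. p e * F e)"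
    by (intro sum.cong refl) (simp add: marginal flip: sum_distrib_right)
  finally show "(\<Sum>G\<in>Pow E. b G * (\<Sum>e\<in>G. F e)) = (\<Sum>e\<in>E. p e * F e)" .
qed

text \<open>The logarithm of a product weight is a constant plus a sum over the chosen links, so its
  mean follows from the marginals. A factor \<open>1 - p e = 0\<close> does no harm: where the
  weight is nonzero, \<open>e\<close> belongs to \<open>G\<close> and the two occurrences of
  \<open>ln (1 - p e)\<close> cancel.\<close>

lemma ex_product_pmf:
  fixes p :: "'e \<Rightarrow> real"
  assumes fin: "finite E" and p: "\<And>e. e \<in> E \<Longrightarrow> 0 \<le> p e" "\<And>e. e \<in> E \<Longrightarrow> p e \<le> 1"
  shows "\<exists>P. set_pmf P \<subseteq> Pow E
    \<and> (\<forall>F. (\<Sum>G\<in>Pow E. pmf P G * (\<Sum>e\<in>G. F e)) = (\<Sum>e\<in>E. p e * F e))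
    \<and> shannon_entropy (Pow E) P = - (\<Sum>e\<in>E. p e * ln (p e) + (1 - p e) * ln (1 - p e))"
proof -
  define b where "b = (\<lambda>G. (\<Prod>e\<in>G. p e) * (\<Prod>e\<in>E - G. 1 - p e))"
  have sums: "sum b (Pow E) = 1" "(\<Sum>G\<in>Pow E. b G * (\<Sum>e\<in>G. F e)) = (\<Sum>e\<in>E. p e * F e)" for F
    using sum_product_weights[OF fin, of p] by (simp_all add: b_def)
  define w where "w = (\<lambda>G. if G \<subseteq> E then b G else 0)"
  have w: "w G = b G" if "G \<in> Pow E" for G using that by (simp add: w_def)
  have "\<exists>P. pmf P = w \<and> set_pmf P \<subseteq> Pow E"
  proof (rule ex_pmf_of_weights)
    show "0 \<le> w G" for G using p by (auto simp: w_def b_def subset_iff intro!: mult_nonneg_nonneg prod_nonneg)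
    have "sum w (Pow E) = sum b (Pow E)" by (intro sum.cong refl w)
    then show "sum w (Pow E) = 1" using sums(1) by simp
  qed (use fin in \<open>auto simp: w_def\<close>)
  then obtain P where P: "pmf P = w" "set_pmf P \<subseteq> Pow E" by blast
  have lin: "(\<Sum>G\<in>Pow E. pmf P G * (\<Sum>e\<in>G. F e)) = (\<Sum>e\<in>E. p e * F e)" for F
    unfolding sums(2)[symmetric] P(1) by (intro sum.cong refl) (simp add: w)
  have "(\<Sum>G\<in>Pow E. pmf P G * ln (pmf P G))
      = (\<Sum>G\<in>Pow E. pmf P G * ((\<Sum>e\<in>G. ln (p e) - ln (1 - p e)) + (\<Sum>e\<in>E. ln (1 - p e))))"
  proof (rule sum.cong[OF refl])
    fix G assume G: "G \<in> Pow E"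
    show "pmf P G * ln (pmf P G) = pmf P G * ((\<Sum>e\<in>G. ln (p e) - ln (1 - p e)) + (\<Sum>e\<in>E. ln (1 - p e)))"
    proof (cases "pmf P G = 0")
      case False
      then have "(\<Prod>e\<in>G. p e) \<noteq> 0" "(\<Prod>e\<in>E - G. 1 - p e) \<noteq> 0"
        using w[OF G] by (auto simp: P b_def)
      moreover have finG: "finite G" using G fin finite_subset by blast
      ultimately have nz: "\<And>e. e \<in> G \<Longrightarrow> p e \<noteq> 0" "\<And>e. e \<in> E - G \<Longrightarrow> 1 - p e \<noteq> 0"
        using fin by (auto simp: prod_zero_iff)
      have "0 < p e" if "e \<in> G" for e
        using nz(1)[OF that] p(1)[of e] G that by (auto simp: order_less_le)
      moreover have "0 < 1 - p e" if "e \<in> E - G" for e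
        using nz(2)[OF that] p(2)[of e] that by (auto simp: order_less_le)
      ultimately have pos: "0 < (\<Prod>e\<in>G. p e)" "0 < (\<Prod>e\<in>E - G. 1 - p e)"
        by (auto intro!: prod_pos)
      have "ln (pmf P G) = ln (\<Prod>e\<in>G. p e) + ln (\<Prod>e\<in>E - G. 1 - p e)"
        using pos by (simp add: P w[OF G] b_def ln_mult)
      also have "\<dots> = (\<Sum>e\<in>G. ln (p e)) + (\<Sum>e\<in>E - G. ln (1 - p e))"
        using pos nz finG fin p G by (subst (1 2) ln_prod) (auto simp: order_less_le)
      also have "(\<Sum>e\<in>E - G. ln (1 - p e)) = (\<Sum>e\<in>E. ln (1 - p e)) - (\<Sum>e\<in>G. ln (1 - p e))"
        using fin G by (intro sum_diff) auto
      finally show ?thesis by (simp add: sum_subtractf)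
    qed simp
  qed
  also have "\<dots> = (\<Sum>e\<in>E. p e * (ln (p e) - ln (1 - p e))) + (\<Sum>e\<in>E. ln (1 - p e))"
    using fin P(2) by (simp add: distrib_left sum.distrib lin sum_pmf_eq_1 flip: sum_distrib_right)
  also have "\<dots> = (\<Sum>e\<in>E. p e * ln (p e) + (1 - p e) * ln (1 - p e))"
    unfolding sum.distrib[symmetric] by (intro sum.cong) (auto simp: algebra_simps)
  finally show ?thesis using P lin by (auto simp: shannon_entropy_def)
qed

section \<open>Double counting of links and nodes\<close>

definition links :: "'a set \<Rightarrow> 'a set set" where
  "links V = {e. e \<subseteq> V \<and> card e = 2}"

lemma finite_links: "finite V \<Longrightarrow> finite (links V)"
  by (rule finite_subset[of _ "Pow V"]) (auto simp: links_def)

lemma sum_incident_links: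
  fixes F :: "'a set \<Rightarrow> 'b :: comm_monoid_add"
  assumes i: "i \<in> V"
  shows "(\<Sum>e | e \<in> links V \<and> i \<in> e. F e) = (\<Sum>j\<in>V - {i}. F {i, j})"
proof -
  have "{e. e \<in> links V \<and> i \<in> e} = (\<lambda>j. {i, j}) ` (V - {i})"
  proof (intro equalityI subsetI)
    fix e assume "e \<in> {e. e \<in> links V \<and> i \<in> e}"
    then have e: "e \<subseteq> V" "card e = 2" "i \<in> e" by (auto simp: links_def)
    then obtain x y where "e = {x, y}" "x \<noteq> y" by (meson card_2_iff)
    then show "e \<in> (\<lambda>j. {i, j}) ` (V - {i})" using e by auto
  qed (use i in \<open>auto simp: links_def\<close>)
  moreover have "inj_on (\<lambda>j. {i, j}) (V - {i})" by (auto simp: inj_on_def doubleton_eq_iff)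
  ultimately show ?thesis by (simp add: sum.reindex)
qed

lemma sum_links_vertices:
  fixes H :: "'a set \<Rightarrow> 'a \<Rightarrow> 'b :: comm_monoid_add"
  assumes "finite V" "G \<subseteq> links V"
  shows "(\<Sum>e\<in>G. \<Sum>i\<in>e. H e i) = (\<Sum>i\<in>V. \<Sum>e | e \<in> G \<and> i \<in> e. H e i)"
proof -
  have "finite G" using assms finite_links finite_subset by blast
  have "(\<Sum>e\<in>G. \<Sum>i\<in>e. H e i) = (\<Sum>e\<in>G. \<Sum>i | i \<in> V \<and> i \<in> e. H e i)"
    using assms by (intro sum.cong refl) (auto simp: links_def subset_iff)
  also have "\<dots> = (\<Sum>i\<in>V. \<Sum>e | e \<in> G \<and> i \<in> e. H e i)"
    using \<open>finite G\<close> assms(1) by (rule sum.swap_restrict)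
  finally show ?thesis .
qed

lemma sum_links_twice:
  fixes F :: "'a set \<Rightarrow> real"
  assumes "finite V" "G \<subseteq> links V"
  shows "2 * (\<Sum>e\<in>G. F e) = (\<Sum>i\<in>V. \<Sum>e | e \<in> G \<and> i \<in> e. F e)"
proof -
  have "2 * (\<Sum>e\<in>G. F e) = (\<Sum>e\<in>G. \<Sum>i\<in>e. F e)"
    unfolding sum_distrib_left using assms(2) by (intro sum.cong) (auto simp: links_def)
  also have "\<dots> = (\<Sum>i\<in>V. \<Sum>e | e \<in> G \<and> i \<in> e. F e)" by (rule sum_links_vertices[OF assms])
  finally show ?thesis .
qed

lemma simple_graphs_links: "simple_graphs n = Pow (links {1..n})"
  by (simp add: simple_graphs_def links_def)

lemma node_degree_card:
  assumes "G \<in> simple_graphs n" "i \<in> {1..n}"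
  shows "node_degree n G i = card {e \<in> G. i \<in> e}"
proof -
  have G: "G \<subseteq> links {1..n}" using assms by (simp add: simple_graphs_links)
  have "node_degree n G i = (\<Sum>e | e \<in> links {1..n} \<and> i \<in> e. of_bool (e \<in> G))"
    by (simp only: node_degree_def adj_def sum_incident_links[OF assms(2)])
  also have "\<dots> = (\<Sum>e | e \<in> G \<and> i \<in> e. 1)"
    using G finite_links[of "{1..n}"] by (intro sum.mono_neutral_cong_right) auto
  finally show ?thesis by simp
qed

text \<open>The additive form of the degree whose mean \<open>ex_product_pmf\<close> can
  compute.\<close>

lemma node_degree_sum:
  assumes G: "G \<in> simple_graphs n" and i: "i \<in> {1..n}"
  shows "real (node_degree n G i) = (\<Sum>e\<in>G. of_bool (i \<in> e))"
proof -
  have "finite G" using G finite_links[of "{1..n}"] finite_subset by (auto simp: simple_graphs_links)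
  then show ?thesis by (simp add: node_degree_card[OF G i] Int_def of_bool_def sum.If_cases)
qed

definition degree_constraint :: "nat \<Rightarrow> (nat \<Rightarrow> nat) \<Rightarrow> nat set set pmf \<Rightarrow> bool" where
  "degree_constraint n k = soft_constraint (simple_graphs n) {1..n}
     (\<lambda>G i. real (node_degree n G i)) (\<lambda>i. real (k i))"

lemma finite_simple_graphs: "finite (simple_graphs n)"
  by (simp add: simple_graphs_links finite_links)

text \<open>On the graphs charged by \<open>Q\<close>, \<open>ln (w G)\<close> is affine in the
  degrees of \<open>G\<close>, so its mean depends only on the prescribed degrees. Normalisation
  costs \<open>ln Z\<close>, at most the sum of the odds and hence at most \<open>N / 2\<close>.
  Odds, unlike probabilities, may exceed 1.\<close>

theorem shannon_entropy_upper_bound: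
  assumes Q: "degree_constraint n k Q" and N: "N = (\<Sum>i=1..n. real (k i))" "N > 0"
  shows "shannon_entropy (simple_graphs n) Q
    \<le> N / 2 * ln N + N / 2 - (\<Sum>i=1..n. real (k i) * ln (real (k i)))"
proof -
  let ?V = "{1..n}"
  let ?E = "links ?V"
  define r where "r = (\<lambda>e. (\<Prod>i\<in>e. real (k i)) / N)"
  define Z where "Z = (\<Prod>e\<in>?E. 1 + r e)"
  define w where "w = (\<lambda>G. (\<Prod>e\<in>G. r e) / Z)"
  have finE: "finite ?E" by (simp add: finite_links)
  have r0: "0 \<le> r e" for e using N by (simp add: r_def prod_nonneg)
  have Z0: "Z > 0" using r0 by (auto simp: Z_def intro!: prod_pos add_pos_nonneg)
  have supp: "set_pmf Q \<subseteq> Pow ?E" using Q by (simp add: degree_constraint_def soft_constraint_def simple_graphs_links)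
  have mean: "(\<Sum>G\<in>simple_graphs n. pmf Q G * real (node_degree n G i)) = real (k i)" if "i \<in> ?V" for i
    using Q that by (simp add: degree_constraint_def soft_constraint_def)
  \<comment> \<open>A node of prescribed degree 0 is isolated in every graph charged by
    \<open>Q\<close>, so \<open>w\<close> is positive where Gibbs' inequality needs it.\<close>
  have rpos: "0 < k i" if G: "G \<in> set_pmf Q" and e: "e \<in> G" "i \<in> e" for G e i
  proof (rule ccontr)
    assume "\<not> 0 < k i"
    have "e \<in> ?E" using supp G e by blast
    then have iV: "i \<in> ?V" using e unfolding links_def by blast
    have GS: "G \<in> simple_graphs n" using supp G by (auto simp: simple_graphs_links)
    have "(\<Sum>G\<in>simple_graphs n. pmf Q G * real (node_degree n G i)) = 0"
      using mean[OF iV] \<open>\<not> 0 < k i\<close> by simp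
    then have "pmf Q G * real (node_degree n G i) = 0"
      using GS finite_simple_graphs by (subst (asm) sum_nonneg_eq_0_iff) auto
    then have "node_degree n G i = 0" using G by (simp add: set_pmf_iff)
    moreover have "finite G" using GS finE finite_subset by (auto simp: simple_graphs_links)
    ultimately show False using e node_degree_card[OF GS iV] by auto
  qed
  have "shannon_entropy (simple_graphs n) Q \<le> - (\<Sum>G\<in>simple_graphs n. pmf Q G * ln (w G))"
  proof (rule shannon_entropy_le_cross_entropy[OF finite_simple_graphs])
    show "set_pmf Q \<subseteq> simple_graphs n" using supp by (simp add: simple_graphs_links)
    show "sum w (simple_graphs n) \<le> 1"
      using prod_add[OF finE, of r "\<lambda>_. 1"] Z0
      by (simp add: w_def Z_def simple_graphs_links add.commute flip: sum_divide_distrib)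
    show "0 \<le> w G" for G using Z0 r0 by (simp add: w_def prod_nonneg)
    show "0 < w G" if "G \<in> set_pmf Q" for G
      using Z0 N(2) rpos[OF that] by (auto simp: w_def r_def intro!: divide_pos_pos prod_pos)
  qed
  also have "(\<Sum>G\<in>simple_graphs n. pmf Q G * ln (w G))
    = (\<Sum>G\<in>simple_graphs n. pmf Q G * ((\<Sum>i\<in>?V. real (node_degree n G i) * (ln (real (k i)) - ln N / 2)) - ln Z))"
  proof (rule sum.cong[OF refl])
    fix G assume GS: "G \<in> simple_graphs n"
    show "pmf Q G * ln (w G)
      = pmf Q G * ((\<Sum>i\<in>?V. real (node_degree n G i) * (ln (real (k i)) - ln N / 2)) - ln Z)"
    proof (cases "G \<in> set_pmf Q")
      case True
      have GE: "G \<subseteq> ?E" using GS by (simp add: simple_graphs_links)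
      have finG: "finite G" using GE finE finite_subset by blast
      have kpos: "0 < k i" if "e \<in> G" "i \<in> e" for e i using rpos[OF True that] .
      have repos: "0 < r e" if "e \<in> G" for e
        using N(2) kpos[OF that] by (auto simp: r_def intro!: divide_pos_pos prod_pos)
      have lnr: "ln (r e) = (\<Sum>i\<in>e. ln (real (k i)) - ln N / 2)" if e: "e \<in> G" for e
      proof -
        have "card e = 2" using e GE by (auto simp: links_def)
        moreover from this have "finite e" using card_ge_0_finite by force
        moreover have "0 < (\<Prod>i\<in>e. real (k i))" using kpos[OF e] by (auto intro!: prod_pos)
        moreover have "ln (\<Prod>i\<in>e. real (k i)) = (\<Sum>i\<in>e. ln (real (k i)))"
          using kpos[OF e] \<open>finite e\<close> by (intro ln_prod) auto
        ultimately show ?thesis using N(2) kpos[OF e] by (simp add: r_def ln_div sum_subtractf)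
      qed
      have "ln (w G) = (\<Sum>e\<in>G. ln (r e)) - ln Z"
      proof -
        have "0 < prod r G" using repos by (rule prod_pos)
        then have "ln (w G) = ln (prod r G) - ln Z"
          unfolding w_def using Z0 by (intro ln_divide_pos)
        also have "ln (prod r G) = (\<Sum>e\<in>G. ln (r e))"
          using finG by (rule ln_prod) (metis repos less_irrefl)
        finally show ?thesis .
      qed
      also have "(\<Sum>e\<in>G. ln (r e)) = (\<Sum>e\<in>G. \<Sum>i\<in>e. ln (real (k i)) - ln N / 2)"
        using lnr by simp
      also have "\<dots> = (\<Sum>i\<in>?V. \<Sum>e | e \<in> G \<and> i \<in> e. ln (real (k i)) - ln N / 2)"
        using GE by (intro sum_links_vertices) auto
      also have "\<dots> = (\<Sum>i\<in>?V. real (node_degree n G i) * (ln (real (k i)) - ln N / 2))"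
        using node_degree_card[OF GS] by (intro sum.cong refl) simp
      finally show ?thesis by simp
    qed (simp add: set_pmf_iff)
  qed
  also have "\<dots> = (\<Sum>i\<in>?V. \<Sum>G\<in>simple_graphs n. pmf Q G * (real (node_degree n G i) * (ln (real (k i)) - ln N / 2))) - ln Z"
    using sum_pmf_eq_1[OF finite_simple_graphs, of Q n] supp
    by (subst sum.swap) (simp add: right_diff_distrib sum_subtractf sum_distrib_left simple_graphs_links flip: sum_distrib_right)
  also have "\<dots> = (\<Sum>i\<in>?V. real (k i) * (ln (real (k i)) - ln N / 2)) - ln Z"
    using mean by (simp flip: sum_distrib_right mult.assoc)
  also have "\<dots> = (\<Sum>i\<in>?V. real (k i) * ln (real (k i))) - N / 2 * ln N - ln Z"
    by (simp add: N(1) right_diff_distrib sum_subtractf sum_divide_distrib[symmetric] flip: sum_distrib_right)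
  finally have 1: "shannon_entropy (simple_graphs n) Q
    \<le> N / 2 * ln N - (\<Sum>i\<in>?V. real (k i) * ln (real (k i))) + ln Z" by simp
  have "ln Z = (\<Sum>e\<in>?E. ln (1 + r e))"
    unfolding Z_def using finE by (rule ln_prod) (metis r0 add_pos_nonneg less_irrefl zero_less_one)
  also have "\<dots> \<le> (\<Sum>e\<in>?E. r e)" using r0 by (intro sum_mono ln_add_one_self_le_self) 
  also have "\<dots> \<le> N / 2"
  proof -
    have "2 * (\<Sum>e\<in>?E. r e) = (\<Sum>i\<in>?V. \<Sum>j\<in>?V - {i}. r {i, j})"
      by (simp add: sum_links_twice[OF _ subset_refl] sum_incident_links)
    also have "\<dots> \<le> (\<Sum>i\<in>?V. \<Sum>j\<in>?V. real (k i) * real (k j) / N)"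
    proof (rule sum_mono)
      fix i
      have "(\<Sum>j\<in>?V - {i}. r {i, j}) = (\<Sum>j\<in>?V - {i}. real (k i) * real (k j) / N)"
        by (intro sum.cong refl) (auto simp: r_def)
      also have "\<dots> \<le> (\<Sum>j\<in>?V. real (k i) * real (k j) / N)"
        using N(2) by (intro sum_mono2) auto
      finally show "(\<Sum>j\<in>?V - {i}. r {i, j}) \<le> (\<Sum>j\<in>?V. real (k i) * real (k j) / N)" .
    qed
    also have "\<dots> = N" using N by (simp flip: sum_divide_distrib sum_distrib_left sum_distrib_right)
    finally show ?thesis by simp
  qed
  finally show ?thesis using 1 by linarith
qed

text \<open>The weights are the Chung--Lu probabilities \<open>\<kappa> i * \<kappa> j / N\<close> with a correction factor
  \<open>1 + s i + s j\<close> that makes the expected degrees exact; the linear system for \<open>s\<close> is solved by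
  \<open>s i = (\<kappa> i / N - S) / (1 - 2 * \<kappa> i / N)\<close>, where \<open>S = (\<Sum>i\<in>V. \<kappa> i / N * s i)\<close>.\<close>

lemma ex_corrected_weights:
  fixes \<kappa> :: "'a \<Rightarrow> real"
  assumes V: "finite V" and \<kappa>: "\<And>i. i \<in> V \<Longrightarrow> 0 \<le> \<kappa> i" "\<And>i. i \<in> V \<Longrightarrow> \<kappa> i \<le> K"
    and N: "N = sum \<kappa> V" "0 < N" "4 * K \<le> N"
  shows "\<exists>s. (\<forall>i\<in>V. \<bar>s i\<bar> \<le> 2 * (K / N))
    \<and> (\<forall>i\<in>V. (\<Sum>j\<in>V - {i}. \<kappa> i * \<kappa> j / N * (1 + s i + s j)) = \<kappa> i)"
proof -
  define q where "q = (\<lambda>i. \<kappa> i / N)"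
  define A where "A = (\<Sum>i\<in>V. q i / (1 - 2 * q i))"
  \<comment> \<open>Found by inserting \<open>s\<close> into
    \<open>S = (\<Sum>i\<in>V. q i * s i)\<close> and solving this linear equation for
    \<open>S\<close>.\<close>
  define S where "S = (\<Sum>i\<in>V. q i * (q i / (1 - 2 * q i))) / (1 + A)"
  define s where "s = (\<lambda>i. (q i - S) / (1 - 2 * q i))"
  have q: "0 \<le> q i" "q i \<le> K / N" "q i \<le> 1 / 4" if "i \<in> V" for i
  proof -
    show "0 \<le> q i" "q i \<le> K / N" using \<kappa> that N by (auto simp: q_def divide_right_mono)
    moreover have "K / N \<le> 1 / 4" using N by (simp add: field_simps)
    ultimately show "q i \<le> 1 / 4" by linarith
  qed
  have sum_q: "sum q V = 1" using N by (simp add: q_def flip: sum_divide_distrib)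
  have t0: "0 \<le> q i / (1 - 2 * q i)" if "i \<in> V" for i using q[OF that] by simp
  then have A0: "0 \<le> A" unfolding A_def by (rule sum_nonneg)
  have "V \<noteq> {}" using N by auto
  then obtain i0 where "i0 \<in> V" by blast
  then have KN: "0 \<le> K / N" using q[OF \<open>i0 \<in> V\<close>] by linarith
  have "0 \<le> (\<Sum>i\<in>V. q i * (q i / (1 - 2 * q i)))"
    by (intro sum_nonneg mult_nonneg_nonneg q(1) t0)
  then have S0: "0 \<le> S" using A0 by (simp add: S_def)
  have "(\<Sum>i\<in>V. q i * (q i / (1 - 2 * q i))) \<le> (\<Sum>i\<in>V. K / N * (q i / (1 - 2 * q i)))"
    using q t0 by (intro sum_mono mult_right_mono) auto
  also have "\<dots> = K / N * A" by (simp add: A_def sum_distrib_left)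
  also have "\<dots> \<le> K / N * (1 + A)" using KN by (intro mult_left_mono) auto
  finally have S1: "S \<le> K / N" using A0 by (simp add: S_def pos_divide_le_eq)
  have sum_qs: "(\<Sum>i\<in>V. q i * s i) = S"
  proof -
    have "(\<Sum>i\<in>V. q i * s i) = (\<Sum>i\<in>V. q i * (q i / (1 - 2 * q i)) - S * (q i / (1 - 2 * q i)))"
      by (intro sum.cong refl) (simp add: s_def diff_divide_distrib algebra_simps)
    also have "\<dots> = (\<Sum>i\<in>V. q i * (q i / (1 - 2 * q i))) - S * A"
      by (simp only: sum_subtractf A_def sum_distrib_left)
    also have "(\<Sum>i\<in>V. q i * (q i / (1 - 2 * q i))) = S * (1 + A)" using A0 by (simp add: S_def)
    finally show ?thesis by (simp add: algebra_simps)
  qed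
  have bound: "\<bar>s i\<bar> \<le> 2 * (K / N)" if i: "i \<in> V" for i
  proof -
    have "\<bar>q i - S\<bar> \<le> K / N" using q[OF i] S0 S1 by linarith
    then have "\<bar>q i - S\<bar> / (1 - 2 * q i) \<le> (K / N) / (1 / 2)"
      using q[OF i] KN by (intro frac_le) auto
    moreover have "\<bar>s i\<bar> = \<bar>q i - S\<bar> / (1 - 2 * q i)"
      using q[OF i] by (simp add: s_def abs_divide)
    ultimately show ?thesis by (simp add: mult.commute)
  qed
  have row: "(\<Sum>j\<in>V - {i}. \<kappa> i * \<kappa> j / N * (1 + s i + s j)) = \<kappa> i" if i: "i \<in> V" for i
  proof -
    have "(\<Sum>j\<in>V - {i}. \<kappa> i * \<kappa> j / N * (1 + s i + s j))
      = (\<Sum>j\<in>V - {i}. \<kappa> i * ((1 + s i) * q j + q j * s j))"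
      by (intro sum.cong refl) (simp add: q_def algebra_simps add_divide_distrib)
    also have "\<dots> = \<kappa> i * ((1 + s i) * (\<Sum>j\<in>V - {i}. q j) + (\<Sum>j\<in>V - {i}. q j * s j))"
      by (simp add: sum.distrib flip: sum_distrib_left)
    also have "\<dots> = \<kappa> i * ((1 + s i) * (1 - q i) + (S - q i * s i))"
      using V i sum_q sum_qs by (simp add: sum_diff1)
    also have "\<dots> = \<kappa> i * (1 - q i + s i * (1 - 2 * q i) + S)" by (simp add: algebra_simps)
    also have "s i * (1 - 2 * q i) = q i - S" using q[OF i] by (simp add: s_def)
    finally show ?thesis by simp
  qed
  show ?thesis using bound row by blast
qed

text \<open>This rests on \<open>ln (1 - p) \<le> - p\<close>. In the lower bound the squares sum to
  at most the largest \<open>p\<close> times the sum of all \<open>p\<close>, that is, to at most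
  \<open>K ^ 2\<close>.\<close>

lemma binary_entropy_ge:
  fixes p :: real
  assumes "0 \<le> p" "p \<le> 1"
  shows "p * ln p + (1 - p) * ln (1 - p) \<le> p * ln p - p + p\<^sup>2"
proof (cases "p = 1")
  case False
  then have "ln (1 - p) \<le> - p" using assms ln_le_minus_one[of "1 - p"] by simp
  then have "(1 - p) * ln (1 - p) \<le> (1 - p) * (- p)" using assms by (intro mult_left_mono) auto
  then show ?thesis by (simp add: power2_eq_square algebra_simps)
qed simp

text \<open>The corrected Chung-Lu measure satisfies the constraints exactly and so competes with
  the maximiser. The correction factors cost at most \<open>N / 2 * \<delta> = 2 * K\<close> and the
  squares of the link probabilities at most \<open>K ^ 2\<close>, in total at most
  \<open>3 * K ^ 2\<close>.\<close>

theorem shannon_entropy_lower_bound: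
  assumes Q: "is_arg_max (shannon_entropy (simple_graphs n)) (degree_constraint n k) Q"
    and N: "N = (\<Sum>i=1..n. real (k i))" "4 * real K ^ 2 \<le> N"
    and K: "\<And>i. i \<in> {1..n} \<Longrightarrow> k i \<le> K" "K \<ge> 1"
  shows "N / 2 * ln N + N / 2 - (\<Sum>i=1..n. real (k i) * ln (real (k i))) - 3 * real K ^ 2
    \<le> shannon_entropy (simple_graphs n) Q"
proof -
  let ?V = "{1..n}"
  let ?E = "links ?V"
  let ?\<kappa> = "\<lambda>i. real (k i)"
  have K1: "1 \<le> real K" "real K \<le> real K ^ 2" using K(2) self_le_power[of "real K" 2] by auto
  then have N0: "0 < N" "4 * real K \<le> N" using N(2) by linarith+
  define \<delta> where "\<delta> = 4 * (real K / N)"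
  have \<delta>: "0 \<le> \<delta>" "\<delta> \<le> 1" using N0 by (auto simp: \<delta>_def field_simps)
  obtain s where s: "\<And>i. i \<in> ?V \<Longrightarrow> \<bar>s i\<bar> \<le> 2 * (real K / N)"
    and row: "\<And>i. i \<in> ?V \<Longrightarrow> (\<Sum>j\<in>?V - {i}. ?\<kappa> i * ?\<kappa> j / N * (1 + s i + s j)) = ?\<kappa> i"
  proof -
    have "\<exists>s. (\<forall>i\<in>?V. \<bar>s i\<bar> \<le> 2 * (real K / N))
      \<and> (\<forall>i\<in>?V. (\<Sum>j\<in>?V - {i}. ?\<kappa> i * ?\<kappa> j / N * (1 + s i + s j)) = ?\<kappa> i)"
      using K N(1) N0 by (intro ex_corrected_weights) auto
    then show ?thesis using that by blast
  qed
  define p where "p = (\<lambda>e. (\<Prod>i\<in>e. ?\<kappa> i) / N * (1 + (\<Sum>i\<in>e. s i)))"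
  have p_pair: "p {i, j} = ?\<kappa> i * ?\<kappa> j / N * (1 + s i + s j)" if "i \<noteq> j" for i j
    using that by (simp add: p_def add.assoc)
  have finE: "finite ?E" by (simp add: finite_links)
  have prow: "(\<Sum>e | e \<in> ?E \<and> i \<in> e. p e) = ?\<kappa> i" if i: "i \<in> ?V" for i
  proof -
    have "(\<Sum>e | e \<in> ?E \<and> i \<in> e. p e) = (\<Sum>j\<in>?V - {i}. p {i, j})" by (rule sum_incident_links[OF i])
    also have "\<dots> = (\<Sum>j\<in>?V - {i}. ?\<kappa> i * ?\<kappa> j / N * (1 + s i + s j))"
      by (intro sum.cong refl p_pair) auto
    finally show ?thesis using row[OF i] by simp
  qed
  have edge: "0 \<le> p e \<and> p e \<le> 2 * real K ^ 2 / N \<and> p e \<le> 1 \<and>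
      p e * ln (p e) \<le> p e * ((\<Sum>i\<in>e. ln (?\<kappa> i)) - ln N + \<delta>)" if e: "e \<in> ?E" for e
  proof -
    obtain i j where ij: "e = {i, j}" "i \<noteq> j" "i \<in> ?V" "j \<in> ?V"
      using e by (auto simp: links_def card_2_iff)
    have abs: "\<bar>s i + s j\<bar> \<le> \<delta>" using s[OF ij(3)] s[OF ij(4)] by (simp add: \<delta>_def)
    then have f: "0 \<le> 1 + s i + s j" "1 + s i + s j \<le> 2" using \<delta> by linarith+
    have pe: "p e = ?\<kappa> i * ?\<kappa> j / N * (1 + s i + s j)" using ij p_pair by simp
    have p0: "0 \<le> p e" using f N0 by (simp add: pe)
    have "?\<kappa> i * ?\<kappa> j \<le> real K * real K" using K ij by (intro mult_mono) auto
    then have "?\<kappa> i * ?\<kappa> j / N \<le> real K ^ 2 / N"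
      using N0 by (intro divide_right_mono) (auto simp: power2_eq_square)
    then have "p e \<le> real K ^ 2 / N * 2" unfolding pe using f N0 by (intro mult_mono) auto
    then have p2: "p e \<le> 2 * real K ^ 2 / N" by (simp add: mult.commute)
    have "2 * real K ^ 2 / N \<le> 1" using N(2) N0 by (simp add: field_simps)
    then have p1: "p e \<le> 1" using p2 by linarith
    have "p e * ln (p e) \<le> p e * ((\<Sum>i\<in>e. ln (?\<kappa> i)) - ln N + \<delta>)"
    proof (cases "p e = 0")
      case False
      then have "?\<kappa> i \<noteq> 0" "?\<kappa> j \<noteq> 0" "1 + s i + s j \<noteq> 0" by (auto simp: pe)
      then have pos: "0 < ?\<kappa> i" "0 < ?\<kappa> j" "0 < 1 + s i + s j" using f(1) by linarith+
      have "ln (p e) = ln (?\<kappa> i) + ln (?\<kappa> j) - ln N + ln (1 + s i + s j)"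
        unfolding pe using pos N0 by (simp add: ln_mult_pos ln_divide_pos)
      moreover have "ln (1 + s i + s j) \<le> \<delta>"
        using ln_le_minus_one[OF pos(3)] abs by linarith
      moreover have "(\<Sum>i\<in>e. ln (?\<kappa> i)) = ln (?\<kappa> i) + ln (?\<kappa> j)" using ij by simp
      ultimately have "ln (p e) \<le> (\<Sum>i\<in>e. ln (?\<kappa> i)) - ln N + \<delta>" by linarith
      then show ?thesis using p0 by (rule mult_left_mono)
    qed simp
    with p0 p1 p2 show ?thesis by blast
  qed
  obtain P where P: "set_pmf P \<subseteq> Pow ?E"
    "\<And>F. (\<Sum>G\<in>Pow ?E. pmf P G * (\<Sum>e\<in>G. F e)) = (\<Sum>e\<in>?E. p e * F e)"
    "shannon_entropy (Pow ?E) P = - (\<Sum>e\<in>?E. p e * ln (p e) + (1 - p e) * ln (1 - p e))"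
    using ex_product_pmf[OF finE, of p] edge by blast
  have "degree_constraint n k P"
    unfolding degree_constraint_def soft_constraint_def
  proof (intro conjI ballI)
    show "set_pmf P \<subseteq> simple_graphs n" using P by (simp add: simple_graphs_links)
    fix i assume i: "i \<in> ?V"
    have "(\<Sum>G\<in>simple_graphs n. pmf P G * real (node_degree n G i))
      = (\<Sum>G\<in>Pow ?E. pmf P G * (\<Sum>e\<in>G. of_bool (i \<in> e)))"
      using node_degree_sum[OF _ i] by (intro sum.cong) (auto simp: simple_graphs_links)
    also have "\<dots> = (\<Sum>e\<in>?E. p e * of_bool (i \<in> e))" by (rule P(2))
    also have "\<dots> = (\<Sum>e | e \<in> ?E \<and> i \<in> e. p e)"
      using finE by (intro sum.mono_neutral_cong_right) auto
    finally show "(\<Sum>G\<in>simple_graphs n. pmf P G * real (node_degree n G i)) = ?\<kappa> i" using prow[OF i] by simp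
  qed
  then have "shannon_entropy (simple_graphs n) P \<le> shannon_entropy (simple_graphs n) Q"
    using Q by (auto simp: is_arg_max_linorder)
  then have H: "- shannon_entropy (simple_graphs n) Q \<le> (\<Sum>e\<in>?E. p e * ln (p e) + (1 - p e) * ln (1 - p e))"
    using P(3) by (simp add: simple_graphs_links)
  have sum_p: "(\<Sum>e\<in>?E. p e) = N / 2"
  proof -
    have "2 * (\<Sum>e\<in>?E. p e) = (\<Sum>i\<in>?V. \<Sum>e | e \<in> ?E \<and> i \<in> e. p e)"
      by (rule sum_links_twice) auto
    also have "\<dots> = N" using prow by (simp add: N(1))
    finally show ?thesis by simp
  qed
  have sum_ln: "(\<Sum>e\<in>?E. p e * (\<Sum>i\<in>e. ln (?\<kappa> i))) = (\<Sum>i\<in>?V. ?\<kappa> i * ln (?\<kappa> i))"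
  proof -
    have "(\<Sum>e\<in>?E. \<Sum>i\<in>e. p e * ln (?\<kappa> i)) = (\<Sum>i\<in>?V. \<Sum>e | e \<in> ?E \<and> i \<in> e. p e * ln (?\<kappa> i))"
      by (rule sum_links_vertices) auto
    also have "\<dots> = (\<Sum>i\<in>?V. ?\<kappa> i * ln (?\<kappa> i))"
      using prow by (intro sum.cong refl) (simp flip: sum_distrib_right)
    finally show ?thesis by (simp add: sum_distrib_left)
  qed
  note H
  also have "(\<Sum>e\<in>?E. p e * ln (p e) + (1 - p e) * ln (1 - p e))
    \<le> (\<Sum>e\<in>?E. p e * ((\<Sum>i\<in>e. ln (?\<kappa> i)) - ln N + \<delta>) - p e + p e * (2 * real K ^ 2 / N))"
  proof (rule sum_mono)
    fix e assume e: "e \<in> ?E"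
    have "p e * p e \<le> p e * (2 * real K ^ 2 / N)" using edge[OF e] by (intro mult_left_mono) auto
    then show "p e * ln (p e) + (1 - p e) * ln (1 - p e)
      \<le> p e * ((\<Sum>i\<in>e. ln (?\<kappa> i)) - ln N + \<delta>) - p e + p e * (2 * real K ^ 2 / N)"
      using binary_entropy_ge[of "p e"] edge[OF e] by (simp add: power2_eq_square[of "p e"])
  qed
  also have "\<dots> = (\<Sum>e\<in>?E. p e * (\<Sum>i\<in>e. ln (?\<kappa> i))) + (\<Sum>e\<in>?E. p e) * (\<delta> - ln N - 1 + 2 * real K ^ 2 / N)"
    unfolding sum_distrib_right sum.distrib[symmetric] by (intro sum.cong refl) (simp add: algebra_simps)
  also have "\<dots> = (\<Sum>i\<in>?V. ?\<kappa> i * ln (?\<kappa> i)) + N / 2 * (\<delta> - ln N - 1 + 2 * real K ^ 2 / N)"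
    by (simp only: sum_ln sum_p)
  also have "N / 2 * (\<delta> - ln N - 1 + 2 * real K ^ 2 / N) = 2 * real K + real K ^ 2 - N / 2 * ln N - N / 2"
    using N0 by (simp add: \<delta>_def field_simps)
  finally show ?thesis using K1 by linarith
qed

section \<open>The relative entropy for a single degree sequence\<close>

lemma ln_fact_g_weight: "ln (fact m) = real m * ln (real m) - real m + g_weight m"
proof (cases "m = 0")
  case False
  then show ?thesis by (simp add: g_weight_def ln_div ln_mult ln_realpow)
qed (simp add: g_weight_def)

text \<open>For \<open>x = m + 1\<close> the terms of orders \<open>m\<close> and
  \<open>m + 1\<close> in the series of \<open>exp x\<close> are equal and positive. The second
  alone gives the weak inequality, and the first makes it strict.\<close>

lemma g_weight_Suc_pos: "0 < g_weight (Suc m)"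
proof -
  define x where "x = real (Suc m)"
  have "(\<Sum>j\<in>{m, Suc m}. x ^ j / fact j) \<le> exp x"
  proof -
    have "(\<Sum>j\<in>{m, Suc m}. inverse (fact j) *\<^sub>R x ^ j) \<le> (\<Sum>j. inverse (fact j) *\<^sub>R x ^ j)"
      by (intro sum_le_suminf summable_exp_generic) (auto simp: x_def)
    then show ?thesis by (simp add: exp_def divide_inverse mult.commute)
  qed
  moreover have "0 < x ^ m / fact m" by (simp add: x_def)
  ultimately have "x ^ Suc m / fact (Suc m) < exp x" by simp
  then have "x ^ Suc m / exp x < fact (Suc m)"
    by (simp only: pos_divide_less_eq fact_gt_zero exp_gt_zero mult.commute)
  moreover have "0 < x ^ Suc m / exp x" by (simp add: x_def)
  ultimately have "1 < fact (Suc m) / (x ^ Suc m / exp x)" by (simp only: less_divide_eq_1_pos)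
  then have "1 < fact (Suc m) / (x ^ Suc m * exp (- x))"
    by (simp only: exp_minus divide_inverse[of "x ^ Suc m"])
  then show ?thesis unfolding g_weight_def x_def by (rule ln_gt_zero)
qed

lemma g_weight_0 [simp]: "g_weight 0 = 0"
  by (simp add: g_weight_def)

lemma g_weight_nonneg [simp]: "0 \<le> g_weight m"
  using g_weight_Suc_pos by (cases m) (auto intro: less_imp_le)

text \<open>Induction reduces this to \<open>1 \<le> (x + 1) * (ln (x + 1) - ln x)\<close>. The
  bound serves the leftover remainders for \<open>L\<close> and \<open>2 * L\<close>.\<close>

lemma g_weight_Suc_le: "g_weight (Suc m) \<le> 1 + ln (real (Suc m))"
proof (induction m)
  case 0
  then show ?case by (simp add: g_weight_def ln_div)
next
  case (Suc m)
  define x where "x = real (Suc m)"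
  have x: "x > 0" "real (Suc (Suc m)) = x + 1" by (simp_all add: x_def)
  have "ln (fact (Suc (Suc m)) :: real) = ln (x + 1) + ln (fact (Suc m))"
    using x by (simp only: fact_Suc[of "Suc m"] of_nat_mult ln_mult_pos fact_gt_zero x(2))
  then have "g_weight (Suc (Suc m)) = g_weight (Suc m) + x * ln x + 1 - x * ln (x + 1)"
    unfolding ln_fact_g_weight x(2) x_def[symmetric] by (simp add: algebra_simps)
  moreover have "1 / (x + 1) \<le> ln (x + 1) - ln x"
    using ln_le_minus_one[of "x / (x + 1)"] x by (simp add: ln_div field_simps)
  then have "1 \<le> (x + 1) * (ln (x + 1) - ln x)" using x by (simp add: field_simps)
  ultimately show ?case using Suc x unfolding x_def[symmetric] x(2) by (simp add: algebra_simps)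
qed

text \<open>The half-links, each named by its node; words over this multiset are the configurations
  of the pairing model.\<close>

definition degree_multiset :: "nat \<Rightarrow> (nat \<Rightarrow> nat) \<Rightarrow> nat multiset" where
  "degree_multiset n k = (\<Sum>i\<in>{1..n}. replicate_mset (k i) i)"

lemma count_degree_multiset: "count (degree_multiset n k) i = (if i \<in> {1..n} then k i else 0)"
  by (simp add: degree_multiset_def count_sum if_distrib[of "\<lambda>m. count m i"] sum.delta cong: if_cong)

lemma size_degree_multiset: "size (degree_multiset n k) = (\<Sum>i=1..n. k i)"
  by (simp add: degree_multiset_def)

lemma realizations_degree_multiset:
  "realizations (degree_multiset n k) = {G \<in> simple_graphs n. \<forall>i\<in>{1..n}. node_degree n G i = k i}"
proof (intro equalityI subsetI)
  fix G assume G: "G \<in> realizations (degree_multiset n k)"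
  then have fin: "finite G" and two: "\<forall>e\<in>G. card e = 2"
    and deg: "\<And>i. card {e \<in> G. i \<in> e} = (if i \<in> {1..n} then k i else 0)"
    by (auto simp: realizations_def count_degree_multiset)
  have "e \<subseteq> {1..n}" if e: "e \<in> G" for e
  proof
    fix i assume "i \<in> e"
    then have "{e \<in> G. i \<in> e} \<noteq> {}" using e by blast
    then show "i \<in> {1..n}" using deg[of i] fin by (auto split: if_splits)
  qed
  then have "G \<in> simple_graphs n" using two by (auto simp: simple_graphs_def)
  then show "G \<in> {G \<in> simple_graphs n. \<forall>i\<in>{1..n}. node_degree n G i = k i}"
    using deg by (simp add: node_degree_card)
next
  fix G assume "G \<in> {G \<in> simple_graphs n. \<forall>i\<in>{1..n}. node_degree n G i = k i}"
  then have G: "G \<in> simple_graphs n" and deg: "\<And>i. i \<in> {1..n} \<Longrightarrow> card {e \<in> G. i \<in> e} = k i"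
    by (auto simp: node_degree_card)
  have "finite G" using G finite_links[of "{1..n}"] finite_subset by (auto simp: simple_graphs_links)
  moreover have "{e \<in> G. i \<in> e} = {}" if "i \<notin> {1..n}" for i
    using G that unfolding simple_graphs_def by blast
  ultimately show "G \<in> realizations (degree_multiset n k)"
    using G deg by (auto simp: realizations_def count_degree_multiset simple_graphs_def)
qed

text \<open>The main terms cancel exactly, leaving the sum of the weights and the difference of the
  remainders for \<open>2 * L\<close> and \<open>L\<close>. The entropy error
  \<open>3 * K ^ 2\<close> can only lower the relative entropy and the counting error
  \<open>80 * K ^ 2\<close> can only raise it, so they do not add up.\<close>

theorem relative_entropy_estimate:
  assumes gr: "graphical n k" and N: "N = (\<Sum>i=1..n. real (k i))"
    and K: "\<And>i. i \<in> {1..n} \<Longrightarrow> k i \<le> K" "K \<ge> 1" and large: "640 * real K ^ 2 \<le> N"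
  shows "\<bar>relative_entropy (simple_graphs n) (P_mic n k) (P_can n k) - (\<Sum>i=1..n. g_weight (k i))\<bar>
    \<le> 80 * real K ^ 2 + 1 + ln N"
proof -
  let ?M = "degree_multiset n k"
  let ?\<Gamma> = "realizations ?M"
  let ?S = "relative_entropy (simple_graphs n) (P_mic n k) (P_can n k)"
  let ?kln = "\<Sum>i=1..n. real (k i) * ln (real (k i))"
  obtain G0 where G0: "G0 \<in> simple_graphs n" "\<And>i. i \<in> {1..n} \<Longrightarrow> node_degree n G0 i = k i"
    using gr by (auto simp: graphical_def)
  then have G0\<Gamma>: "G0 \<in> ?\<Gamma>" by (auto simp: realizations_degree_multiset)
  define L where "L = card G0"
  have size: "size ?M = 2 * L" using card_realization[OF G0\<Gamma>] by (simp add: L_def)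
  then have NL: "N = 2 * real L"
    unfolding N by (metis of_nat_mult of_nat_numeral of_nat_sum size_degree_multiset)
  have "1 \<le> real K ^ 2" using K(2) by simp
  then have N0: "N > 0" "L \<ge> 1" "4 * real K ^ 2 \<le> N" using large NL by auto
  have eq: "{G \<in> simple_graphs n. \<forall>i\<in>{1..n}. real (node_degree n G i) = real (k i)} = ?\<Gamma>"
    by (simp add: realizations_degree_multiset)
  have max: "is_arg_max (shannon_entropy (simple_graphs n)) (degree_constraint n k) (P_can n k)"
    and rel: "?S = shannon_entropy (simple_graphs n) (P_can n k) - ln (real (card ?\<Gamma>))"
    using relative_entropy_microcanonical_canonical[OF finite_simple_graphs, of G0 n "{1..n}"
        "\<lambda>G i. real (node_degree n G i)" "\<lambda>i. real (k i)"] G0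
    unfolding P_mic_def P_can_def degree_constraint_def eq by auto
  have "degree_constraint n k (P_can n k)" using max by (simp add: is_arg_max_def)
  from shannon_entropy_upper_bound[OF this N N0(1)]
  have H_le: "shannon_entropy (simple_graphs n) (P_can n k) \<le> real L * ln N + real L - ?kln"
    by (simp add: NL)
  from shannon_entropy_lower_bound[OF max N N0(3) K]
  have H_ge: "real L * ln N + real L - ?kln - 3 * real K ^ 2 \<le> shannon_entropy (simple_graphs n) (P_can n k)"
    by (simp add: NL)
  \<comment> \<open>The number of orders and orientations of the links, times the number of ways to
    label the half-links at each node.\<close>
  define D where "D = (2 ^ L * fact L * (\<Prod>x\<in>set_mset ?M. fact (count ?M x)) :: real)"
  have "(\<Prod>x\<in>set_mset ?M. fact (count ?M x)) = (\<Prod>i=1..n. fact (k i) :: real)"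
    by (rule prod.mono_neutral_cong_left)
      (auto simp: count_degree_multiset set_mset_def split: if_splits intro!: gr0I)
  then have D: "D = 2 ^ L * fact L * (\<Prod>i=1..n. fact (k i))" by (simp add: D_def)
  have D0: "D > 0" by (auto simp: D intro!: mult_pos_pos prod_pos)
  have \<Gamma>0: "real (card ?\<Gamma>) > 0" using G0\<Gamma> finite_realizations card_gt_0_iff by fastforce
  have lnD: "ln D = real L * ln 2 + (real L * ln (real L) - real L + g_weight L) + (?kln - N + (\<Sum>i=1..n. g_weight (k i)))"
  proof -
    have "ln D = ln (2 ^ L) + ln (fact L) + ln (\<Prod>i=1..n. fact (k i) :: real)"
      unfolding D by (simp add: ln_mult_pos prod_pos)
    also have "ln (\<Prod>i=1..n. fact (k i) :: real) = (\<Sum>i=1..n. ln (fact (k i)))"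
      by (intro ln_prod) auto
    also have "\<dots> = ?kln - N + (\<Sum>i=1..n. g_weight (k i))"
      unfolding ln_fact_g_weight N by (simp add: sum.distrib sum_subtractf)
    finally show ?thesis unfolding ln_fact_g_weight[of L] by (simp add: ln_realpow)
  qed
  have lnN: "ln N = ln 2 + ln (real L)" using N0 by (simp add: NL ln_mult)
  have lnF: "ln (fact (2 * L)) = N * ln N - N + g_weight (2 * L)"
    by (simp add: ln_fact_g_weight NL)
  have "real (card ?\<Gamma>) * D \<le> fact (2 * L)"
    using card_realizations_bounds(1)[OF size] by (simp add: D_def)
  then have "ln (real (card ?\<Gamma>) * D) \<le> ln (fact (2 * L))"
    using \<Gamma>0 D0 by (subst ln_le_cancel_iff) (auto intro: mult_pos_pos)
  then have up: "ln (real (card ?\<Gamma>)) + ln D \<le> ln (fact (2 * L))"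
    using \<Gamma>0 D0 by (simp add: ln_mult_pos)
  have "count ?M y \<le> K" for y using K(1)[of y] by (simp add: count_degree_multiset)
  then have "exp (- 80 * real K ^ 2) * fact (2 * L) \<le> real (card ?\<Gamma>) * D"
    unfolding D_def using size K(2) large NL by (intro card_realizations_bounds(2)) auto
  then have "ln (exp (- 80 * real K ^ 2) * fact (2 * L)) \<le> ln (real (card ?\<Gamma>) * D)"
    using \<Gamma>0 D0 by (subst ln_le_cancel_iff) (auto intro: mult_pos_pos)
  then have low: "- 80 * real K ^ 2 + ln (fact (2 * L)) \<le> ln (real (card ?\<Gamma>)) + ln D"
    using \<Gamma>0 D0 by (simp add: ln_mult_pos)
  have fD: "ln (fact (2 * L)) - ln D = real L * ln N + real L - ?kln - (\<Sum>i=1..n. g_weight (k i)) + g_weight (2 * L) - g_weight L"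
    unfolding lnF lnD by (simp only: lnN) (simp add: NL algebra_simps)
  have "g_weight (2 * L) \<le> 1 + ln N" "g_weight L \<le> 1 + ln N"
  proof -
    show "g_weight (2 * L) \<le> 1 + ln N" using g_weight_Suc_le[of "2 * L - 1"] N0 by (simp add: NL Suc_diff_1)
    have "g_weight L \<le> 1 + ln (real L)" using g_weight_Suc_le[of "L - 1"] N0 by (simp add: Suc_diff_1)
    then show "g_weight L \<le> 1 + ln N" using lnN by (smt (verit) ln_2_less_1 ln_gt_zero)
  qed
  moreover have "0 \<le> g_weight (2 * L)" "0 \<le> g_weight L" by simp_all
  moreover have "0 \<le> real K ^ 2" by simp
  ultimately show ?thesis
    unfolding abs_le_iff using H_le H_ge up low fD rel by (intro conjI) linarith+
qed

section \<open>The sparse limit\<close>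

text \<open>From \<open>m! \<le> m ^ m\<close>. This makes the sum of the weights a lower bound for
  the total degree.\<close>

lemma g_weight_le: "g_weight m \<le> real m"
proof (cases "m = 0")
  case False
  have "(fact m :: real) \<le> real m ^ m" using fact_le_power[of m, where 'a = real] by simp
  then have "ln (fact m) \<le> ln (real m ^ m)" using False by (subst ln_le_cancel_iff) auto
  then show ?thesis using ln_fact_g_weight[of m] False by (simp add: ln_realpow)
qed simp

lemma l1g_norm_triangle:
  assumes "\<And>j. \<bar>h j\<bar> \<le> \<bar>h1 j\<bar> + \<bar>h2 j\<bar>"
  shows "l1g_norm h \<le> l1g_norm h1 + l1g_norm h2"
proof -
  have "l1g_norm h \<le> (\<Sum>j. ennreal (\<bar>h1 j\<bar> * g_weight j) + ennreal (\<bar>h2 j\<bar> * g_weight j))"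
    unfolding l1g_norm_def
  proof (intro suminf_le allI summableI)
    fix j
    have "\<bar>h j\<bar> * g_weight j \<le> (\<bar>h1 j\<bar> + \<bar>h2 j\<bar>) * g_weight j"
      using assms by (intro mult_right_mono) auto
    then have "ennreal (\<bar>h j\<bar> * g_weight j) \<le> ennreal (\<bar>h1 j\<bar> * g_weight j + \<bar>h2 j\<bar> * g_weight j)"
      by (intro ennreal_leI) (simp add: distrib_right)
    then show "ennreal (\<bar>h j\<bar> * g_weight j) \<le> ennreal (\<bar>h1 j\<bar> * g_weight j) + ennreal (\<bar>h2 j\<bar> * g_weight j)"
      by (simp add: ennreal_plus)
  qed
  also have "\<dots> = l1g_norm h1 + l1g_norm h2"
    unfolding l1g_norm_def by (rule suminf_add[symmetric]) auto
  finally show ?thesis .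
qed

text \<open>Regrouping the sum over degrees as a sum over nodes gives the average that
  \<open>relative_entropy_estimate\<close> approximates.\<close>

lemma l1g_norm_empirical: "l1g_norm (empirical n k) = ennreal ((\<Sum>i=1..n. g_weight (k i)) / real n)"
proof -
  let ?J = "k ` {1..n}"
  have emp0: "0 \<le> empirical n k j" for j by (simp add: empirical_def sum_nonneg)
  have "l1g_norm (empirical n k) = (\<Sum>j\<in>?J. ennreal (\<bar>empirical n k j\<bar> * g_weight j))"
    unfolding l1g_norm_def
  proof (rule suminf_finite)
    fix j assume "j \<notin> ?J"
    then have "empirical n k j = 0" unfolding empirical_def by (subst sum.neutral) auto
    then show "ennreal (\<bar>empirical n k j\<bar> * g_weight j) = 0" by simp
  qed simp
  also have "\<dots> = ennreal (\<Sum>j\<in>?J. empirical n k j * g_weight j)"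
    using emp0 by (subst sum_ennreal[symmetric]) auto
  also have "(\<Sum>j\<in>?J. empirical n k j * g_weight j) = (\<Sum>j\<in>?J. \<Sum>i=1..n. of_bool (k i = j) * g_weight j / real n)"
    by (intro sum.cong refl) (simp only: empirical_def sum_divide_distrib sum_distrib_right times_divide_eq_left)
  also have "\<dots> = (\<Sum>i=1..n. \<Sum>j\<in>?J. of_bool (k i = j) * g_weight j / real n)" by (rule sum.swap)
  also have "\<dots> = (\<Sum>i=1..n. g_weight (k i) / real n)"
  proof (rule sum.cong[OF refl])
    fix i assume "i \<in> {1..n}"
    then have "(\<Sum>j\<in>?J. of_bool (k i = j) * g_weight j / real n)
      = (\<Sum>j\<in>?J. if k i = j then g_weight j / real n else 0)"
      by (intro sum.cong refl) auto
    then show "(\<Sum>j\<in>?J. of_bool (k i = j) * g_weight j / real n) = g_weight (k i) / real n"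
      using \<open>i \<in> {1..n}\<close> by (simp add: sum.delta')
  qed
  finally show ?thesis by (simp add: sum_divide_distrib)
qed

text \<open>The hypothesis \<open>nontrivial\<close> excludes the point mass at 0, whose norm is 0
  because \<open>g_weight 0 = 0\<close>, so that positivity would fail.\<close>

theorem theorem1p1:
  fixes k :: "nat \<Rightarrow> nat \<Rightarrow> nat" and f :: "nat pmf"
  assumes graphical: "\<And>n. n \<ge> 1 \<Longrightarrow> graphical n (k n)"
    and sparse: "(\<lambda>n. real (Max (k n ` {1..n}))) \<in> o(\<lambda>n. sqrt (real n))"
    and conv: "(\<lambda>n. l1g_norm (\<lambda>j. empirical n (k n) j - pmf f j)) \<longlonglongrightarrow> 0"
    and nontrivial: "f \<noteq> return_pmf 0"
  shows "l1g_norm (pmf f) < \<infinity>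
    \<and> (\<lambda>n. relative_entropy (simple_graphs n) (P_mic n (k n)) (P_can n (k n)) / real n)
        \<longlonglongrightarrow> enn2real (l1g_norm (pmf f))
    \<and> l1g_norm (pmf f) > 0"
proof (intro conjI)
  define a where "a = (\<lambda>n. (\<Sum>i=1..n. g_weight (k n i)) / real n)"
  define d where "d = (\<lambda>n. l1g_norm (\<lambda>j. empirical n (k n) j - pmf f j))"
  define F where "F = enn2real (l1g_norm (pmf f))"
  have a0: "0 \<le> a n" for n by (simp add: a_def sum_nonneg)
  have f_le: "l1g_norm (pmf f) \<le> ennreal (a n) + d n" for n
    unfolding a_def d_def l1g_norm_empirical[symmetric] by (rule l1g_norm_triangle) linarith
  have a_le: "ennreal (a n) \<le> l1g_norm (pmf f) + d n" for n
    unfolding a_def d_def l1g_norm_empirical[symmetric] by (rule l1g_norm_triangle) linarith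
  have d0: "d \<longlonglongrightarrow> 0" using conv by (simp add: d_def)
  have "eventually (\<lambda>n. d n < 1) sequentially" using d0 by (rule order_tendstoD) simp
  then have d_fin: "eventually (\<lambda>n. d n < \<infinity>) sequentially"
    by eventually_elim (auto intro: less_trans)
  \<comment> \<open>A single finite distance suffices for a finite norm of \<open>f\<close>, since
    empirical distributions have finite norm.\<close>
  then obtain n0 where "d n0 < \<infinity>" by (meson eventually_sequentially order_refl)
  then have "ennreal (a n0) + d n0 < \<infinity>" by simp
  with f_le[of n0] show fin: "l1g_norm (pmf f) < \<infinity>" by (rule le_less_trans)
  then have F: "l1g_norm (pmf f) = ennreal F" "0 \<le> F" by (simp_all add: F_def)
  show pos: "l1g_norm (pmf f) > 0"
  proof -
    have "\<not> set_pmf f \<subseteq> {0}" using nontrivial set_pmf_subset_singleton by metis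
    then obtain j where j: "j \<in> set_pmf f" "j \<noteq> 0" by blast
    then have "0 < pmf f j" "0 < g_weight j"
      using g_weight_Suc_pos[of "j - 1"] by (simp_all add: pmf_positive)
    then have "0 < ennreal (\<bar>pmf f j\<bar> * g_weight j)" by simp
    also have "\<dots> = (\<Sum>i\<in>{j}. ennreal (\<bar>pmf f i\<bar> * g_weight i))" by simp
    also have "\<dots> \<le> l1g_norm (pmf f)"
      unfolding l1g_norm_def by (rule sum_le_suminf) auto
    finally show ?thesis .
  qed
  then have Fpos: "F > 0" using F by simp
  have "(\<lambda>n. enn2real (d n)) \<longlonglongrightarrow> 0" using tendsto_enn2real[of d 0] d0 by simp
  moreover have "eventually (\<lambda>n. norm (a n - F) \<le> enn2real (d n)) sequentially"
    using d_fin
  proof eventually_elim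
    case (elim n)
    then have dn: "d n = ennreal (enn2real (d n))" by simp
    have "ennreal F \<le> ennreal (a n + enn2real (d n))"
      using f_le[of n] a0 dn F by (metis ennreal_plus enn2real_nonneg)
    then have "F \<le> a n + enn2real (d n)" using a0[of n] by (subst (asm) ennreal_le_iff) auto
    moreover have "ennreal (a n) \<le> ennreal (F + enn2real (d n))"
      using a_le[of n] dn F by (metis ennreal_plus enn2real_nonneg)
    then have "a n \<le> F + enn2real (d n)" using F(2) by (subst (asm) ennreal_le_iff) auto
    ultimately show ?case by (simp add: abs_le_iff)
  qed
  ultimately have "(\<lambda>n. a n - F) \<longlonglongrightarrow> 0" by (rule Lim_null_comparison[rotated])
  then have a_lim: "a \<longlonglongrightarrow> F" by (simp add: LIM_zero_iff)
  define K where "K = (\<lambda>n. Max (k n ` {1..n}))"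
  define N where "N = (\<lambda>n. \<Sum>i=1..n. real (k n i))"
  have kK: "k n i \<le> K n" if "i \<in> {1..n}" for n i using that by (auto simp: K_def)
  have "(\<lambda>n. real (K n) / sqrt (real n)) \<longlonglongrightarrow> 0"
    using smalloD_tendsto[OF sparse] by (simp add: K_def)
  from tendsto_power[OF this, of 2]
  have K_lim: "(\<lambda>n. real (K n) ^ 2 / real n) \<longlonglongrightarrow> 0" by (simp add: power_divide)
  define err where "err = (\<lambda>n. 80 * (real (K n) ^ 2 / real n) + 1 / real n + 2 * (ln (real n) / real n))"
  have "(\<lambda>n. 1 / real n) \<longlonglongrightarrow> 0" "(\<lambda>n. ln (real n) / real n) \<longlonglongrightarrow> 0" by real_asymp+
  then have "err \<longlonglongrightarrow> 80 * 0 + 0 + 2 * 0"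
    unfolding err_def by (intro tendsto_add tendsto_mult_left K_lim)
  then have err_lim: "err \<longlonglongrightarrow> 0" by simp
  \<comment> \<open>The bound \<open>F / 1280\<close> makes \<open>640 * K ^ 2\<close> smaller than
    \<open>F / 2 * n\<close>, which is at most \<open>N n\<close>. The bound 1 gives
    \<open>K \<le> n\<close>, hence \<open>N \<le> n ^ 2\<close> and
    \<open>ln N \<le> 2 * ln n\<close>.\<close>
  have ev: "eventually (\<lambda>n. F / 2 < a n) sequentially" "eventually (\<lambda>n. real (K n) ^ 2 / real n < min 1 (F / 1280)) sequentially"
    using order_tendstoD(1)[OF a_lim, of "F / 2"] order_tendstoD(2)[OF K_lim, of "min 1 (F / 1280)"] Fpos by auto
  have "eventually (\<lambda>n. norm (relative_entropy (simple_graphs n) (P_mic n (k n)) (P_can n (k n)) / real n - a n) \<le> err n) sequentially"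
    using ev eventually_ge_at_top[of 1]
  proof eventually_elim
    case (elim n)
    let ?n = "real n"
    let ?S = "relative_entropy (simple_graphs n) (P_mic n (k n)) (P_can n (k n))"
    have n: "?n \<ge> 1" using elim by simp
    have "(\<Sum>i=1..n. g_weight (k n i)) \<le> N n" unfolding N_def by (intro sum_mono g_weight_le)
    then have "a n * ?n \<le> N n" using n by (simp add: a_def)
    moreover have "F / 2 * ?n \<le> a n * ?n" using elim n by (intro mult_right_mono) auto
    ultimately have NF: "F / 2 * ?n \<le> N n" by linarith
    have K2: "real (K n) ^ 2 < F / 1280 * ?n" "real (K n) ^ 2 < ?n" using elim n by (simp_all add: field_simps)
    then have large: "640 * real (K n) ^ 2 \<le> N n" using NF by linarith
    have "N n > 0" using NF Fpos n by (smt (verit) mult_pos_pos half_gt_zero)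
    have "K n \<noteq> 0"
    proof
      assume "K n = 0"
      then have "k n i = 0" if "i \<in> {1..n}" for i using kK[OF that] by simp
      then have "N n = 0" by (simp add: N_def)
      with \<open>N n > 0\<close> show False by simp
    qed
    then have K1: "K n \<ge> 1" by simp
    have "real (K n) \<le> real (K n) ^ 2" using K1 self_le_power[of "real (K n)" 2] by simp
    then have "real (K n) \<le> ?n" using K2 by linarith
    then have "N n \<le> (\<Sum>i=1..n. ?n)"
      unfolding N_def using kK by (intro sum_mono) (meson of_nat_mono order_trans)
    then have "N n \<le> ?n ^ 2" by (simp add: power2_eq_square)
    then have "ln (N n) \<le> ln (?n ^ 2)" using \<open>N n > 0\<close> n by (subst ln_le_cancel_iff) auto
    then have lnN: "ln (N n) \<le> 2 * ln ?n" using n by (simp add: ln_realpow)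
    have "\<bar>?S - (\<Sum>i=1..n. g_weight (k n i))\<bar> \<le> 80 * real (K n) ^ 2 + 1 + ln (N n)"
      using elim graphical kK K1 large by (intro relative_entropy_estimate) (auto simp: N_def)
    then have "\<bar>?S - (\<Sum>i=1..n. g_weight (k n i))\<bar> / ?n \<le> (80 * real (K n) ^ 2 + 1 + 2 * ln ?n) / ?n"
      using lnN n by (intro divide_right_mono) auto
    also have "\<dots> = err n" by (simp add: err_def add_divide_distrib)
    also have "\<bar>?S - (\<Sum>i=1..n. g_weight (k n i))\<bar> / ?n = norm (?S / ?n - a n)"
      by (simp add: a_def diff_divide_distrib[symmetric])
    finally show ?case .
  qed
  then have "(\<lambda>n. relative_entropy (simple_graphs n) (P_mic n (k n)) (P_can n (k n)) / real n - a n) \<longlonglongrightarrow> 0"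
    using err_lim by (rule Lim_null_comparison)
  from tendsto_add[OF this a_lim]
  show "(\<lambda>n. relative_entropy (simple_graphs n) (P_mic n (k n)) (P_can n (k n)) / real n)
        \<longlonglongrightarrow> enn2real (l1g_norm (pmf f))" by (simp add: F_def)
qed

end
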